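(* There is a constant $c>0$ such that for every $f\in L^{2,\infty}(\mathbb{R}^2)\cap\dot H^1(\mathbb{R}^2)$, $$\|f\|_{L^4}\le c\,\|f\|_{L^{2,\infty}}^{1/2}\,\|\nabla f\|_{L^2}^{1/2}.$$ Moreover, if $\Omega\subset\mathbb{R}^2$ is a bounded Lipschitz domain, the same inequality (with all norms taken over $\Omega$) holds for every $f\in H^1_0(\Omega)$.
   Context: For measurable, a.e.-finite $f$ on a measurable set $\Omega\subset\mathbb{R}^n$ let $d_f(\alpha)=\mu\{x\in\Omega:|f(x)|>\alpha\}$ ($\mu$ Lebesgue measure). For $1\le p<\infty$, the weak $L^p$ space $L^{p,\infty}(\Omega)$ is the set of such $f$ for which the quasi-norm $\|f\|_{L^{p,\infty}}=\inf\{C>0: d_f(\alpha)\le C^p/\alpha^p\ \text{for all }\alpha>0\}$ is finite. $\dot H^1(\mathbb{R}^2)$ is the homogeneous Sobolev space of functions with $\nabla f\in L^2(\mathbb{R}^2)$. *)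

theory Defs
  imports "HOL-Analysis.Analysis"
begin

text \<open>
  Functions on \<open>\<Omega>\<close> are total functions of which only the values on \<open>\<Omega>\<close> matter, and all function
  spaces are sets of functions rather than of classes modulo a.e. equality. All norms take
  values in \<open>[0,\<infinity>]\<close>, so that an inequality with finite right-hand side asserts in particular that
  the left-hand side is finite.
\<close>

text \<open>Powers of extended nonnegative reals, meant for a positive exponent.\<close>

definition enn_powr :: "ennreal \<Rightarrow> real \<Rightarrow> ennreal" where
  "enn_powr x r = (if x = \<infinity> then \<infinity> else ennreal (enn2real x powr r))"

definition Lp_norm :: "real \<Rightarrow> 'a::euclidean_space set \<Rightarrow> ('a \<Rightarrow> 'b::euclidean_space) \<Rightarrow> ennreal" where
  "Lp_norm p \<Omega> f = enn_powr (\<integral>\<^sup>+x. ennreal (norm (f x) powr p) \<partial>lebesgue_on \<Omega>) (1 / p)"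

definition Lp :: "real \<Rightarrow> 'a::euclidean_space set \<Rightarrow> ('a \<Rightarrow> 'b::euclidean_space) set" where
  "Lp p \<Omega> = {f \<in> borel_measurable (lebesgue_on \<Omega>). Lp_norm p \<Omega> f < \<infinity>}"

definition distribution_fun :: "'a::euclidean_space set \<Rightarrow> ('a \<Rightarrow> real) \<Rightarrow> real \<Rightarrow> ennreal" where
  "distribution_fun \<Omega> f \<alpha> = emeasure lebesgue {x \<in> \<Omega>. \<bar>f x\<bar> > \<alpha>}"

definition weak_Lp_norm :: "real \<Rightarrow> 'a::euclidean_space set \<Rightarrow> ('a \<Rightarrow> real) \<Rightarrow> ennreal" where
  "weak_Lp_norm p \<Omega> f =
     Inf {ennreal C | C. C > 0 \<and>
       (\<forall>\<alpha>>0. distribution_fun \<Omega> f \<alpha> \<le> ennreal (C powr p / \<alpha> powr p))}"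

definition weak_Lp :: "real \<Rightarrow> 'a::euclidean_space set \<Rightarrow> ('a \<Rightarrow> real) set" where
  "weak_Lp p \<Omega> = {f \<in> borel_measurable (lebesgue_on \<Omega>). weak_Lp_norm p \<Omega> f < \<infinity>}"

primrec Ck :: "nat \<Rightarrow> ('a::euclidean_space \<Rightarrow> real) \<Rightarrow> bool" where
  "Ck 0 \<phi> \<longleftrightarrow> continuous_on UNIV \<phi>"
| "Ck (Suc k) \<phi> \<longleftrightarrow> (\<forall>x. \<phi> differentiable (at x)) \<and>
     (\<forall>i\<in>Basis. Ck k (\<lambda>x. frechet_derivative \<phi> (at x) i))"

definition test_functions :: "'a::euclidean_space set \<Rightarrow> ('a \<Rightarrow> real) set" where
  "test_functions \<Omega> = {\<phi>. (\<forall>k. Ck k \<phi>) \<and>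
     compact (closure {x. \<phi> x \<noteq> 0}) \<and> closure {x. \<phi> x \<noteq> 0} \<subseteq> \<Omega>}"

definition gradient :: "('a::euclidean_space \<Rightarrow> real) \<Rightarrow> 'a \<Rightarrow> 'a" where
  "gradient \<phi> x = (\<Sum>i\<in>Basis. frechet_derivative \<phi> (at x) i *\<^sub>R i)"

definition locally_integrable ::
    "'a::euclidean_space set \<Rightarrow> ('a \<Rightarrow> 'b::euclidean_space) \<Rightarrow> bool" where
  "locally_integrable \<Omega> f \<longleftrightarrow> (\<forall>K. compact K \<and> K \<subseteq> \<Omega> \<longrightarrow> integrable (lebesgue_on K) f)"

definition has_weak_gradient ::
    "'a::euclidean_space set \<Rightarrow> ('a \<Rightarrow> real) \<Rightarrow> ('a \<Rightarrow> 'a) \<Rightarrow> bool" where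
  "has_weak_gradient \<Omega> f g \<longleftrightarrow> locally_integrable \<Omega> f \<and> locally_integrable \<Omega> g \<and>
     (\<forall>\<phi>\<in>test_functions \<Omega>.
        (LINT x|lebesgue_on \<Omega>. f x *\<^sub>R gradient \<phi> x) = - (LINT x|lebesgue_on \<Omega>. \<phi> x *\<^sub>R g x))"

text \<open>For open \<open>\<Omega>\<close> the weak gradient, if it exists, is unique up to a.e. equality on \<open>\<Omega>\<close>.\<close>

definition weak_gradient :: "'a::euclidean_space set \<Rightarrow> ('a \<Rightarrow> real) \<Rightarrow> 'a \<Rightarrow> 'a" where
  "weak_gradient \<Omega> f = (SOME g. has_weak_gradient \<Omega> f g)"

definition homogeneous_H1 :: "'a::euclidean_space set \<Rightarrow> ('a \<Rightarrow> real) set" where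
  "homogeneous_H1 \<Omega> = {f. (\<exists>g. has_weak_gradient \<Omega> f g) \<and> weak_gradient \<Omega> f \<in> Lp 2 \<Omega>}"

definition H1 :: "'a::euclidean_space set \<Rightarrow> ('a \<Rightarrow> real) set" where
  "H1 \<Omega> = Lp 2 \<Omega> \<inter> homogeneous_H1 \<Omega>"

text \<open>The closure of the test functions in \<open>H1 \<Omega>\<close>.\<close>

definition H10 :: "'a::euclidean_space set \<Rightarrow> ('a \<Rightarrow> real) set" where
  "H10 \<Omega> = {f \<in> H1 \<Omega>. \<exists>\<phi>. (\<forall>k::nat. \<phi> k \<in> test_functions \<Omega>) \<and>
     (\<lambda>k. Lp_norm 2 \<Omega> (\<lambda>x. \<phi> k x - f x)) \<longlonglongrightarrow> 0 \<and>
     (\<lambda>k. Lp_norm 2 \<Omega> (\<lambda>x. gradient (\<phi> k) x - weak_gradient \<Omega> f x)) \<longlonglongrightarrow> 0}"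

text \<open>
  Near each boundary point, \<open>\<Omega>\<close> is the part above the graph of a Lipschitz function \<open>\<gamma>\<close> defined on
  the hyperplane orthogonal to some unit vector \<open>e\<close>; \<open>x - (x \<bullet> e) *\<^sub>R e\<close> is the projection of \<open>x\<close>
  to this hyperplane.
\<close>

definition bounded_Lipschitz_domain :: "'a::euclidean_space set \<Rightarrow> bool" where
  "bounded_Lipschitz_domain \<Omega> \<longleftrightarrow> open \<Omega> \<and> connected \<Omega> \<and> \<Omega> \<noteq> {} \<and> bounded \<Omega> \<and>
     (\<forall>z\<in>frontier \<Omega>. \<exists>r>0. \<exists>e L \<gamma>. norm e = 1 \<and> L-lipschitz_on {y. y \<bullet> e = 0} \<gamma> \<and>
        \<Omega> \<inter> ball z r = {x \<in> ball z r. \<gamma> (x - (x \<bullet> e) *\<^sub>R e) < x \<bullet> e})"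

end

theory Submission
  imports Defs
begin

text \<open>
  The proof combines a truncation at dyadic levels with the Sobolev embedding of \<open>W\<^sup>1\<^sup>,\<^sup>1\<close> of the
  plane into \<open>L\<^sup>2\<close>. Let \<open>F\<close> be a function of the plane with continuous partial derivatives and
  with \<open>\<bar>{\<bar>F\<bar> > l}\<bar> \<le> V / l\<^sup>2\<close> for all \<open>l > 0\<close>, and let \<open>A\<close> be the set where \<open>l < \<bar>F\<bar> < 2 * l\<close>. If
  \<open>2 * l \<le> \<bar>F\<bar>\<close> at a point, then on almost every horizontal or vertical line through such points
  \<open>F\<close> also takes a value of modulus at most \<open>l\<close>, for otherwise the set where \<open>\<bar>F\<bar> > l\<close> would have infinite
  measure; hence the partial derivative along the line has integral at least \<open>l\<close> over the part of
  the line in \<open>A\<close>. Multiplying the bounds for the two directions, integrating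
  (\<open>level_set_product_bound\<close>) and applying the Cauchy-Schwarz inequality on \<open>A\<close> gives
  
    \<open>l\<^sup>2 * \<bar>{\<bar>F\<bar> \<ge> 2 * l}\<bar> \<le> \<bar>A\<bar> * (integral of \<bar>grad F\<bar>\<^sup>2 over A)\<close>,
  
  and \<open>\<bar>A\<bar> \<le> V / l\<^sup>2\<close> turns the left-hand side into the contribution \<open>l^4 * \<bar>{\<bar>F\<bar> \<ge> 2 * l}\<bar>\<close> of one
  level to the integral of \<open>F^4\<close>. For levels in geometric progression the sets \<open>A\<close> are disjoint,
  and summation yields \<open>\<integral> F^4 \<le> 256 * V * \<integral> \<bar>grad F\<bar>\<^sup>2\<close> (\<open>L4_bound_C1\<close>), which is the fourth power
  of the inequality.
  
  For a weakly differentiable \<open>f\<close> on the plane the estimate is applied to mollifications. They have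
  no larger energy (\<open>mollify_energy\<close>), and their weak \<open>L\<^sup>2\<close> norm is controlled as well
  (\<open>mollify_weak_bound\<close>). With kernels that approximate the normalized indicator of a box, the
  mollifications converge to the averages of \<open>f\<close> over boxes, and these converge to \<open>f\<close> almost
  everywhere; Fatou's lemma concludes. For \<open>f \<in> H10 \<Omega>\<close> the estimate is applied directly to the test
  functions that approximate \<open>f\<close>, whose weak norms are bounded by that of \<open>f\<close> up to an error tending
  to 0 (\<open>L4_bound_test_function\<close>).
\<close>

section \<open>Lebesgue measure on the plane\<close>

text \<open>
  Fatou's lemma, in the form in which every limit passage below uses it.
\<close>
lemma nn_integral_le_of_AE_tendsto:
  fixes u :: "nat \<Rightarrow> 'a \<Rightarrow> ennreal"
  assumes [measurable]: "\<And>n. u n \<in> borel_measurable M"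
    and lim: "AE x in M. (\<lambda>n. u n x) \<longlonglongrightarrow> v x"
    and le: "\<And>n. (\<integral>\<^sup>+x. u n x \<partial>M) \<le> K n" and K: "K \<longlonglongrightarrow> L"
  shows "(\<integral>\<^sup>+x. v x \<partial>M) \<le> L"
proof -
  have "(\<integral>\<^sup>+x. v x \<partial>M) = (\<integral>\<^sup>+x. liminf (\<lambda>n. u n x) \<partial>M)"
    by (rule nn_integral_cong_AE, use lim in eventually_elim) (simp add: lim_imp_Liminf)
  also have "\<dots> \<le> liminf (\<lambda>n. \<integral>\<^sup>+x. u n x \<partial>M)"
    by (rule nn_integral_liminf) auto
  also have "\<dots> \<le> liminf K"
    by (intro Liminf_mono always_eventually allI le)
  also have "\<dots> = L" using K by (simp add: lim_imp_Liminf)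
  finally show ?thesis .
qed

lemma plane_measurable [measurable]:
  "(\<lambda>p. vector [fst p, snd p] :: real^2) \<in> borel_measurable (lborel \<Otimes>\<^sub>M lborel)"
proof -
  have eq: "(\<lambda>p. vector [fst p, snd p] :: real^2) = (\<lambda>p. fst p *\<^sub>R axis 1 1 + snd p *\<^sub>R axis 2 1)"
    by (auto simp: fun_eq_iff vec_eq_iff forall_2 axis_def)
  show ?thesis unfolding eq by measurable
qed

lemma plane_measurable_swap [measurable]:
  "(\<lambda>p. vector [snd p, fst p] :: real^2) \<in> borel_measurable (lborel \<Otimes>\<^sub>M lborel)"
  using measurable_compose[OF measurable_pair_swap' plane_measurable] by (simp add: case_prod_beta)

lemma lborel_plane:
  "lborel = distr (lborel \<Otimes>\<^sub>M lborel) borel (\<lambda>p. vector [fst p, snd p] :: real^2)"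
proof (rule lborel_eqI)
  fix l u :: "real^2"
  assume le: "\<And>b. b \<in> Basis \<Longrightarrow> l \<bullet> b \<le> u \<bullet> b"
  have B: "(Basis :: (real^2) set) = {axis 1 1, axis 2 1}"
    by (auto simp: Basis_vec_def exhaust_2 axis_def) (metis exhaust_2)
  have ne: "axis 1 (1::real) \<noteq> (axis 2 1 :: real^2)" by (simp add: axis_eq_axis)
  have le1: "l $ 1 \<le> u $ 1" "l $ 2 \<le> u $ 2"
    using le[of "axis 1 1"] le[of "axis 2 1"] by (auto simp: B inner_axis)
  have "(\<lambda>p. vector [fst p, snd p] :: real^2) -` box l u \<inter> space (lborel \<Otimes>\<^sub>M lborel)
        = {l $ 1 <..< u $ 1} \<times> {l $ 2 <..< u $ 2}"
    by (auto simp: mem_box_cart forall_2 space_pair_measure)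
  then have "emeasure (distr (lborel \<Otimes>\<^sub>M lborel) borel (\<lambda>p. vector [fst p, snd p] :: real^2)) (box l u)
      = emeasure (lborel \<Otimes>\<^sub>M lborel) ({l $ 1 <..< u $ 1} \<times> {l $ 2 <..< u $ 2})"
    by (subst emeasure_distr) auto
  also have "\<dots> = ennreal (u $ 1 - l $ 1) * ennreal (u $ 2 - l $ 2)"
    using le1 by (subst lborel.emeasure_pair_measure_Times) auto
  also have "\<dots> = (\<Prod>b\<in>Basis. (u - l) \<bullet> b)"
    using le1 ne by (auto simp: B inner_axis ennreal_mult inner_diff_left)
  finally show "emeasure (distr (lborel \<Otimes>\<^sub>M lborel) borel (\<lambda>p. vector [fst p, snd p] :: real^2)) (box l u)
      = (\<Prod>b\<in>Basis. (u - l) \<bullet> b)" .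
qed auto

lemma nn_integral_plane:
  fixes w :: "real^2 \<Rightarrow> ennreal"
  assumes [measurable]: "w \<in> borel_measurable borel"
  shows "(\<integral>\<^sup>+p. w p \<partial>lborel) = (\<integral>\<^sup>+x. \<integral>\<^sup>+y. w (vector [x, y]) \<partial>lborel \<partial>lborel)"
    and "(\<integral>\<^sup>+p. w p \<partial>lborel) = (\<integral>\<^sup>+y. \<integral>\<^sup>+x. w (vector [x, y]) \<partial>lborel \<partial>lborel)"
proof -
  have "(\<integral>\<^sup>+p. w p \<partial>lborel) = (\<integral>\<^sup>+p. w (vector [fst p, snd p]) \<partial>(lborel \<Otimes>\<^sub>M lborel))"
    by (subst lborel_plane, subst nn_integral_distr) auto
  moreover have "\<dots> = (\<integral>\<^sup>+x. \<integral>\<^sup>+y. w (vector [x, y]) \<partial>lborel \<partial>lborel)"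
    by (subst lborel.nn_integral_fst[symmetric]) auto
  moreover have "(\<integral>\<^sup>+p. w (vector [fst p, snd p]) \<partial>(lborel \<Otimes>\<^sub>M lborel)) 
     = (\<integral>\<^sup>+y. \<integral>\<^sup>+x. w (vector [x, y]) \<partial>lborel \<partial>lborel)"
    by (subst lborel_pair.nn_integral_snd[symmetric]) auto
  ultimately show "(\<integral>\<^sup>+p. w p \<partial>lborel) = (\<integral>\<^sup>+x. \<integral>\<^sup>+y. w (vector [x, y]) \<partial>lborel \<partial>lborel)"
    "(\<integral>\<^sup>+p. w p \<partial>lborel) = (\<integral>\<^sup>+y. \<integral>\<^sup>+x. w (vector [x, y]) \<partial>lborel \<partial>lborel)" by auto
qed

section \<open>Level sets of differentiable functions of the plane\<close>

text \<open>
  Between the last point where \<open>\<bar>\<phi>\<bar> \<le> l\<close> and the next point where \<open>2 * l \<le> \<bar>\<phi>\<bar>\<close>, the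
  function \<open>\<bar>\<phi>\<bar>\<close> stays strictly between the two levels, so the increment \<open>l\<close> is paid for by
  the derivative on this band alone. This plays the part of a truncation of \<open>\<phi>\<close> at the two
  levels, and spares a chain rule for a truncation that is not differentiable.
\<close>
lemma level_crossing_right:
  fixes \<phi> \<gamma> :: "real \<Rightarrow> real"
  assumes deriv: "\<And>r. (\<phi> has_real_derivative \<gamma> r) (at r)"
    and cont: "continuous_on UNIV \<gamma>"
    and "0 < l" and s: "\<bar>\<phi> s\<bar> \<le> l" and x: "2 * l \<le> \<bar>\<phi> x\<bar>" and "s \<le> x"
  shows "ennreal l \<le> (\<integral>\<^sup>+r. ennreal \<bar>\<gamma> r\<bar> * indicator {r. l < \<bar>\<phi> r\<bar> \<and> \<bar>\<phi> r\<bar> < 2 * l} r \<partial>lborel)"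
proof -
  have c\<phi>: "continuous_on A \<phi>" for A
    using deriv by (meson DERIV_isCont continuous_at_imp_continuous_on)
  have [measurable]: "\<phi> \<in> borel_measurable borel" "\<gamma> \<in> borel_measurable borel"
    using c\<phi> cont borel_measurable_continuous_onI by blast+
  define S where "S = {s..x} \<inter> {r. \<bar>\<phi> r\<bar> \<le> l}"
  have "closed {r. \<bar>\<phi> r\<bar> \<le> l}"
    by (intro closed_Collect_le continuous_intros c\<phi>)
  then have "compact S" unfolding S_def by (intro compact_Int_closed compact_Icc)
  moreover have "s \<in> S" using s \<open>s \<le> x\<close> by (auto simp: S_def)
  ultimately obtain a where a: "a \<in> S" "\<And>r. r \<in> S \<Longrightarrow> r \<le> a"
    using compact_attains_sup[of S] by auto
  define U where "U = {a..x} \<inter> {r. 2 * l \<le> \<bar>\<phi> r\<bar>}"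
  have "closed {r. 2 * l \<le> \<bar>\<phi> r\<bar>}"
    by (intro closed_Collect_le continuous_intros c\<phi>)
  then have "compact U" unfolding U_def by (intro compact_Int_closed compact_Icc)
  moreover have "x \<in> U" using x a(1) by (auto simp: U_def S_def)
  ultimately obtain b where b: "b \<in> U" "\<And>r. r \<in> U \<Longrightarrow> b \<le> r"
    using compact_attains_inf[of U] by auto
  have ab: "a \<le> b" "\<bar>\<phi> a\<bar> \<le> l" "2 * l \<le> \<bar>\<phi> b\<bar>" "s \<le> a" "b \<le> x"
    using a b by (auto simp: S_def U_def)
  have mid: "l < \<bar>\<phi> r\<bar> \<and> \<bar>\<phi> r\<bar> < 2 * l" if "r \<in> {a<..<b}" for r
  proof -
    have "r \<notin> S" "r \<notin> U" using that a(2)[of r] b(2)[of r] by auto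
    with that ab show ?thesis by (auto simp: S_def U_def)
  qed
  have ig: "(\<gamma> has_integral (\<phi> b - \<phi> a)) {a..b}"
    using deriv ab(1) by (intro fundamental_theorem_of_calculus)
      (auto simp: has_real_derivative_iff_has_vector_derivative[symmetric] intro: DERIV_subset)
  have abs_ig: "(\<lambda>r. \<bar>\<gamma> r\<bar>) integrable_on {a..b}"
    by (intro integrable_continuous_real continuous_intros continuous_on_subset[OF cont]) auto
  have "l \<le> \<bar>\<phi> b - \<phi> a\<bar>" using ab by linarith
  also have "\<dots> \<le> integral {a..b} (\<lambda>r. \<bar>\<gamma> r\<bar>)"
    using integral_norm_bound_integral[of \<gamma> "{a..b}" "\<lambda>r. \<bar>\<gamma> r\<bar>"] ig abs_ig
    by (auto simp: integral_unique has_integral_integrable)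
  finally have "ennreal l \<le> ennreal (integral {a..b} (\<lambda>r. \<bar>\<gamma> r\<bar>))"
    by (rule ennreal_leI)
  also have "\<dots> = (\<integral>\<^sup>+r. ennreal (indicator {a<..<b} r * \<bar>\<gamma> r\<bar>) \<partial>lborel)"
    using abs_ig
    by (intro nn_integral_has_integral_lebesgue[symmetric])
       (auto simp: has_integral_Icc_iff_Ioo[symmetric] has_integral_integral)
  also have "\<dots> \<le> (\<integral>\<^sup>+r. ennreal \<bar>\<gamma> r\<bar> * indicator {r. l < \<bar>\<phi> r\<bar> \<and> \<bar>\<phi> r\<bar> < 2 * l} r \<partial>lborel)"
    by (intro nn_integral_mono) (use mid in \<open>auto simp: indicator_def\<close>)
  finally show ?thesis .
qed

lemma level_crossing:
  fixes \<phi> \<gamma> :: "real \<Rightarrow> real"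
  assumes deriv: "\<And>r. (\<phi> has_real_derivative \<gamma> r) (at r)"
    and cont: "continuous_on UNIV \<gamma>"
    and "0 < l" and s: "\<bar>\<phi> s\<bar> \<le> l" and x: "2 * l \<le> \<bar>\<phi> x\<bar>"
  shows "ennreal l \<le> (\<integral>\<^sup>+r. ennreal \<bar>\<gamma> r\<bar> * indicator {r. l < \<bar>\<phi> r\<bar> \<and> \<bar>\<phi> r\<bar> < 2 * l} r \<partial>lborel)"
proof (cases "s \<le> x")
  case True
  then show ?thesis using level_crossing_right assms by blast
next
  case False
  have c\<phi>: "continuous_on A \<phi>" for A
    using deriv by (meson DERIV_isCont continuous_at_imp_continuous_on)
  have [measurable]: "\<phi> \<in> borel_measurable borel" "\<gamma> \<in> borel_measurable borel"
    using c\<phi> cont borel_measurable_continuous_onI by blast+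
  have d: "((\<lambda>r. \<phi> (- r)) has_real_derivative - \<gamma> (- r)) (at r)" for r
    using DERIV_chain'[OF DERIV_minus[OF DERIV_ident] deriv[of "- r"], of UNIV] by simp
  have "continuous_on UNIV (\<lambda>r. - \<gamma> (- r))"
    by (intro continuous_intros continuous_on_compose2[OF cont]) auto
  from level_crossing_right[OF d this \<open>0 < l\<close>, of "- s" "- x"] s x False
  have "ennreal l \<le> (\<integral>\<^sup>+r. ennreal \<bar>\<gamma> (- r)\<bar> * indicator {r. l < \<bar>\<phi> (- r)\<bar> \<and> \<bar>\<phi> (- r)\<bar> < 2 * l} r \<partial>lborel)"
    by simp
  also have "\<dots> = (\<integral>\<^sup>+r. ennreal \<bar>\<gamma> r\<bar> * indicator {r. l < \<bar>\<phi> r\<bar> \<and> \<bar>\<phi> r\<bar> < 2 * l} r \<partial>lborel)"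
    by (subst (2) nn_integral_real_affine[of _ "-1" 0]) (auto simp: indicator_def)
  finally show ?thesis .
qed

lemma Cauchy_Schwarz_on_set:
  assumes [measurable]: "A \<in> sets M" "u \<in> borel_measurable M"
  shows "(\<integral>\<^sup>+x. u x * indicator A x \<partial>M)\<^sup>2 \<le> emeasure M A * (\<integral>\<^sup>+x. u x ^ 2 * indicator A x \<partial>M)"
proof -
  have "(\<integral>\<^sup>+x. u x * indicator A x \<partial>M) = (\<integral>\<^sup>+x. indicator A x * (u x * indicator A x) \<partial>M)"
    by (intro nn_integral_cong) (auto simp: indicator_def)
  also have "\<dots>\<^sup>2 \<le> (\<integral>\<^sup>+x. indicator A x ^ 2 \<partial>M) * (\<integral>\<^sup>+x. (u x * indicator A x) ^ 2 \<partial>M)"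
    by (rule Cauchy_Schwarz_nn_integral) auto
  also have "(\<integral>\<^sup>+x. indicator A x ^ 2 \<partial>M) = (\<integral>\<^sup>+x. indicator A x \<partial>M)"
    by (intro nn_integral_cong) (auto simp: indicator_def)
  also have "(\<integral>\<^sup>+x. (u x * indicator A x) ^ 2 \<partial>M) = (\<integral>\<^sup>+x. u x ^ 2 * indicator A x \<partial>M)"
    by (intro nn_integral_cong) (auto simp: indicator_def)
  finally show ?thesis by simp
qed

text \<open>
  A line on which \<open>\<bar>F\<bar>\<close> exceeds \<open>l\<close> throughout meets the set \<open>{p. l < \<bar>F p\<bar>}\<close> in infinite
  length. By Tonelli's theorem only a null set of parallel lines can do this. This replaces the
  decay at infinity that the Sobolev inequality usually needs.
\<close>
lemma AE_line_meets_low_set: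
  fixes F :: "real^2 \<Rightarrow> real"
  assumes [measurable]: "F \<in> borel_measurable borel"
    and fin: "emeasure lborel {p. l < \<bar>F p\<bar>} < \<infinity>"
  shows "AE y in lborel. \<exists>s. \<bar>F (vector [s, y])\<bar> \<le> l"
    and "AE x in lborel. \<exists>s. \<bar>F (vector [x, s])\<bar> \<le> l"
proof -
  let ?w = "indicator {p. l < \<bar>F p\<bar>} :: real^2 \<Rightarrow> ennreal"
  have e: "(\<integral>\<^sup>+p. ?w p \<partial>lborel) \<noteq> \<infinity>" using fin by simp
  have "AE y in lborel. (\<integral>\<^sup>+x. ?w (vector [x, y]) \<partial>lborel) \<noteq> \<infinity>"
  proof (rule nn_integral_PInf_AE)
    have "(\<lambda>p. ?w (vector [snd p, fst p])) \<in> borel_measurable (lborel \<Otimes>\<^sub>M lborel)"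
      unfolding indicator_def by measurable
    then show "(\<lambda>y. \<integral>\<^sup>+ x. ?w (vector [x, y]) \<partial>lborel) \<in> borel_measurable lborel"
      using lborel.borel_measurable_nn_integral_fst[of "\<lambda>p. ?w (vector [snd p, fst p])" lborel] by simp
  qed (use e in \<open>subst nn_integral_plane(2)[symmetric], auto\<close>)
  then show "AE y in lborel. \<exists>s. \<bar>F (vector [s, y])\<bar> \<le> l"
  proof eventually_elim
    case (elim y)
    show ?case
    proof (rule ccontr)
      assume "\<not> ?case"
      then have "(\<integral>\<^sup>+x. ?w (vector [x, y]) \<partial>lborel) = (\<integral>\<^sup>+(x::real). 1 \<partial>lborel)"
        by (intro nn_integral_cong) (auto simp: indicator_def not_le)
      with elim show False by simp
    qed
  qed
  have "AE x in lborel. (\<integral>\<^sup>+y. ?w (vector [x, y]) \<partial>lborel) \<noteq> \<infinity>"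
  proof (rule nn_integral_PInf_AE)
    have "(\<lambda>p. ?w (vector [fst p, snd p])) \<in> borel_measurable (lborel \<Otimes>\<^sub>M lborel)"
      unfolding indicator_def by measurable
    then show "(\<lambda>x. \<integral>\<^sup>+ y. ?w (vector [x, y]) \<partial>lborel) \<in> borel_measurable lborel"
      using lborel.borel_measurable_nn_integral_fst[of "\<lambda>p. ?w (vector [fst p, snd p])" lborel] by simp
  qed (use e in \<open>subst nn_integral_plane(1)[symmetric], auto\<close>)
  then show "AE x in lborel. \<exists>s. \<bar>F (vector [x, s])\<bar> \<le> l"
  proof eventually_elim
    case (elim x)
    show ?case
    proof (rule ccontr)
      assume "\<not> ?case"
      then have "(\<integral>\<^sup>+y. ?w (vector [x, y]) \<partial>lborel) = (\<integral>\<^sup>+(x::real). 1 \<partial>lborel)"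
        by (intro nn_integral_cong) (auto simp: indicator_def not_le)
      with elim show False by simp
    qed
  qed
qed

text \<open>
  The Gagliardo-Nirenberg argument for the embedding of \<open>W\<^sup>1\<^sup>,\<^sup>1\<close> of the plane into \<open>L\<^sup>2\<close>, for
  one pair of levels. At a point where \<open>2 * l \<le> \<bar>F\<bar>\<close>, almost every horizontal line gives
  \<open>l \<le> a y\<close> and almost every vertical one \<open>l \<le> b x\<close>, where \<open>a\<close> and \<open>b\<close> are the integrals of the
  partial derivatives over the part of the line in \<open>A\<close>. The product \<open>a y * b x\<close> then integrates
  to a product of two integrals over the plane.
\<close>
lemma level_set_product_bound:
  fixes F G1 G2 :: "real^2 \<Rightarrow> real"
  assumes F: "F \<in> borel_measurable borel"
    and G: "continuous_on UNIV G1" "continuous_on UNIV G2"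
    and d1: "\<And>x y. ((\<lambda>s. F (vector [s, y])) has_real_derivative G1 (vector [x, y])) (at x)"
    and d2: "\<And>x y. ((\<lambda>s. F (vector [x, s])) has_real_derivative G2 (vector [x, y])) (at y)"
    and "0 < l" and fin: "emeasure lborel {p. l < \<bar>F p\<bar>} < \<infinity>"
  defines "A \<equiv> {p. l < \<bar>F p\<bar> \<and> \<bar>F p\<bar> < 2 * l}"
  shows "ennreal (l\<^sup>2) * emeasure lborel {p. 2 * l \<le> \<bar>F p\<bar>}
    \<le> (\<integral>\<^sup>+p. ennreal \<bar>G1 p\<bar> * indicator A p \<partial>lborel) * (\<integral>\<^sup>+p. ennreal \<bar>G2 p\<bar> * indicator A p \<partial>lborel)"
proof -
  note F[measurable]
  have [measurable]: "G1 \<in> borel_measurable borel" "G2 \<in> borel_measurable borel"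
    using G borel_measurable_continuous_onI by blast+
  have vc: "continuous_on UNIV (\<lambda>s. vector [s, y] :: real^2)" "continuous_on UNIV (\<lambda>s. vector [x, s] :: real^2)"
    for x y :: real
  proof -
    have "(\<lambda>s. vector [s, y] :: real^2) = (\<lambda>s. s *\<^sub>R axis 1 1 + y *\<^sub>R axis 2 1)"
         "(\<lambda>s. vector [x, s] :: real^2) = (\<lambda>s. x *\<^sub>R axis 1 1 + s *\<^sub>R axis 2 1)"
      by (auto simp: fun_eq_iff vec_eq_iff forall_2 axis_def)
    note eq = this
    show "continuous_on UNIV (\<lambda>s. vector [s, y] :: real^2)"
      unfolding eq by (intro continuous_intros)
    show "continuous_on UNIV (\<lambda>s. vector [x, s] :: real^2)"
      unfolding eq by (intro continuous_intros)
  qed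
  have [measurable]: "A \<in> sets borel" unfolding A_def by measurable
  define a where "a y = (\<integral>\<^sup>+x. ennreal \<bar>G1 (vector [x, y])\<bar> * indicator A (vector [x, y]) \<partial>lborel)" for y
  define b where "b x = (\<integral>\<^sup>+y. ennreal \<bar>G2 (vector [x, y])\<bar> * indicator A (vector [x, y]) \<partial>lborel)" for x
  have a: "AE y in lborel. \<forall>x. 2 * l \<le> \<bar>F (vector [x, y])\<bar> \<longrightarrow> ennreal l \<le> a y"
    using AE_line_meets_low_set(1)[OF F fin]
  proof eventually_elim
    case (elim y)
    then obtain s where s: "\<bar>F (vector [s, y])\<bar> \<le> l" by auto
    have c: "continuous_on UNIV (\<lambda>s. G1 (vector [s, y]))"
      by (rule continuous_on_compose2[OF G(1) vc(1)]) auto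
    show ?case
      using level_crossing[OF d1 c \<open>0 < l\<close> s] by (auto simp: a_def A_def indicator_def)
  qed
  have b: "AE x in lborel. \<forall>y. 2 * l \<le> \<bar>F (vector [x, y])\<bar> \<longrightarrow> ennreal l \<le> b x"
    using AE_line_meets_low_set(2)[OF F fin]
  proof eventually_elim
    case (elim x)
    then obtain s where s: "\<bar>F (vector [x, s])\<bar> \<le> l" by auto
    have c: "continuous_on UNIV (\<lambda>s. G2 (vector [x, s]))"
      by (rule continuous_on_compose2[OF G(2) vc(2)]) auto
    show ?case
      using level_crossing[OF d2 c \<open>0 < l\<close> s] by (auto simp: b_def A_def indicator_def)
  qed
  have [measurable]: "b \<in> borel_measurable lborel" 
    using lborel.borel_measurable_nn_integral_fst[of 
      "\<lambda>p. ennreal \<bar>G2 (vector [fst p, snd p])\<bar> * indicator A (vector [fst p, snd p])" lborel]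
    by (simp add: b_def[abs_def])
  have "ennreal (l\<^sup>2) * emeasure lborel {p. 2 * l \<le> \<bar>F p\<bar>}
      = (\<integral>\<^sup>+p. ennreal (l\<^sup>2) * indicator {p. 2 * l \<le> \<bar>F p\<bar>} p \<partial>lborel)"
    by (subst nn_integral_cmult) auto
  also have "\<dots> = (\<integral>\<^sup>+y. \<integral>\<^sup>+x. ennreal (l\<^sup>2) * indicator {p. 2 * l \<le> \<bar>F p\<bar>} (vector [x, y]) \<partial>lborel \<partial>lborel)"
    by (rule nn_integral_plane) auto
  also have "\<dots> \<le> (\<integral>\<^sup>+y. \<integral>\<^sup>+x. a y * b x \<partial>lborel \<partial>lborel)"
  proof (rule nn_integral_mono_AE, use a in eventually_elim, rule nn_integral_mono_AE, use b in eventually_elim)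
    fix x y
    assume ab: "\<forall>x. 2 * l \<le> \<bar>F (vector [x, y])\<bar> \<longrightarrow> ennreal l \<le> a y"
      "\<forall>y. 2 * l \<le> \<bar>F (vector [x, y])\<bar> \<longrightarrow> ennreal l \<le> b x"
    show "ennreal (l\<^sup>2) * indicator {p. 2 * l \<le> \<bar>F p\<bar>} (vector [x, y]) \<le> a y * b x"
    proof (cases "2 * l \<le> \<bar>F (vector [x, y])\<bar>")
      case True
      then have "ennreal l * ennreal l \<le> a y * b x" using ab by (intro mult_mono) auto
      with True show ?thesis using \<open>0 < l\<close> by (simp add: power2_eq_square ennreal_mult)
    qed auto
  qed
  also have "\<dots> = (\<integral>\<^sup>+y. a y * (\<integral>\<^sup>+x. b x \<partial>lborel) \<partial>lborel)"
    by (subst nn_integral_cmult) auto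
  also have "\<dots> = (\<integral>\<^sup>+y. a y \<partial>lborel) * (\<integral>\<^sup>+x. b x \<partial>lborel)"
  proof (rule nn_integral_multc)
    show "a \<in> borel_measurable lborel"
      using lborel.borel_measurable_nn_integral_fst[of 
        "\<lambda>p. ennreal \<bar>G1 (vector [snd p, fst p])\<bar> * indicator A (vector [snd p, fst p])" lborel]
      by (simp add: a_def[abs_def])
  qed
  also have "(\<integral>\<^sup>+y. a y \<partial>lborel) = (\<integral>\<^sup>+p. ennreal \<bar>G1 p\<bar> * indicator A p \<partial>lborel)"
    unfolding a_def by (rule nn_integral_plane(2)[symmetric]) auto
  also have "(\<integral>\<^sup>+x. b x \<partial>lborel) = (\<integral>\<^sup>+p. ennreal \<bar>G2 p\<bar> * indicator A p \<partial>lborel)"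
    unfolding b_def by (rule nn_integral_plane(1)[symmetric]) auto
  finally show ?thesis .
qed

text \<open>
  The place where the weak norm enters: by Cauchy-Schwarz each of the two factors above is at
  most \<open>sqrt \<bar>A\<bar>\<close> times the \<open>L\<^sup>2\<close> norm of the gradient on \<open>A\<close>, and \<open>\<bar>A\<bar> \<le> V / l\<^sup>2\<close>. Here and below,
  \<open>V\<close> stands for a bound on the square of the weak \<open>L\<^sup>2\<close> norm.
\<close>
lemma level_set_energy_bound:
  fixes F G1 G2 :: "real^2 \<Rightarrow> real"
  assumes F: "F \<in> borel_measurable borel"
    and G: "continuous_on UNIV G1" "continuous_on UNIV G2"
    and d1: "\<And>x y. ((\<lambda>s. F (vector [s, y])) has_real_derivative G1 (vector [x, y])) (at x)"
    and d2: "\<And>x y. ((\<lambda>s. F (vector [x, s])) has_real_derivative G2 (vector [x, y])) (at y)"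
    and "0 < l" and V: "emeasure lborel {p. l < \<bar>F p\<bar>} \<le> ennreal (V / l\<^sup>2)" and "0 \<le> V"
  shows "ennreal (l^4) * emeasure lborel {p. 2 * l \<le> \<bar>F p\<bar>}
    \<le> ennreal V * (\<integral>\<^sup>+p. ennreal ((G1 p)\<^sup>2 + (G2 p)\<^sup>2) * indicator {p. l < \<bar>F p\<bar> \<and> \<bar>F p\<bar> < 2 * l} p \<partial>lborel)"
proof -
  note F[measurable]
  have [measurable]: "G1 \<in> borel_measurable borel" "G2 \<in> borel_measurable borel"
    using G borel_measurable_continuous_onI by blast+
  define A where "A = {p. l < \<bar>F p\<bar> \<and> \<bar>F p\<bar> < 2 * l}"
  define u where "u p = ennreal (sqrt ((G1 p)\<^sup>2 + (G2 p)\<^sup>2))" for p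
  have [measurable]: "A \<in> sets borel" unfolding A_def by measurable
  have [measurable]: "u \<in> borel_measurable borel" unfolding u_def by measurable
  have "emeasure lborel {p. l < \<bar>F p\<bar>} < \<infinity>" using V by (simp add: le_less_trans)
  from level_set_product_bound[OF F G d1 d2 \<open>0 < l\<close> this]
  have "ennreal (l\<^sup>2) * emeasure lborel {p. 2 * l \<le> \<bar>F p\<bar>} \<le>
      (\<integral>\<^sup>+p. ennreal \<bar>G1 p\<bar> * indicator A p \<partial>lborel) * (\<integral>\<^sup>+p. ennreal \<bar>G2 p\<bar> * indicator A p \<partial>lborel)"
    by (simp add: A_def)
  also have "\<dots> \<le> (\<integral>\<^sup>+p. u p * indicator A p \<partial>lborel) * (\<integral>\<^sup>+p. u p * indicator A p \<partial>lborel)"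
    unfolding u_def
    by (intro mult_mono nn_integral_mono mult_right_mono ennreal_leI) auto
  also have "\<dots> \<le> emeasure lborel A * (\<integral>\<^sup>+p. u p ^ 2 * indicator A p \<partial>lborel)"
    using Cauchy_Schwarz_on_set[of A lborel u] by (simp add: power2_eq_square)
  also have "\<dots> \<le> ennreal (V / l\<^sup>2) * (\<integral>\<^sup>+p. ennreal ((G1 p)\<^sup>2 + (G2 p)\<^sup>2) * indicator A p \<partial>lborel)"
  proof (intro mult_mono nn_integral_mono)
    have "emeasure lborel A \<le> emeasure lborel {p. l < \<bar>F p\<bar>}"
      by (intro emeasure_mono) (auto simp: A_def)
    with V show "emeasure lborel A \<le> ennreal (V / l\<^sup>2)" by simp
  qed (auto simp: u_def ennreal_power)
  finally have "ennreal (l\<^sup>2) * (ennreal (l\<^sup>2) * emeasure lborel {p. 2 * l \<le> \<bar>F p\<bar>})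
    \<le> ennreal (l\<^sup>2) * (ennreal (V / l\<^sup>2) * (\<integral>\<^sup>+p. ennreal ((G1 p)\<^sup>2 + (G2 p)\<^sup>2) * indicator A p \<partial>lborel))"
    by (intro mult_left_mono) auto
  moreover have "ennreal (l\<^sup>2) * ennreal (l\<^sup>2) = ennreal (l^4)"
    by (simp add: ennreal_mult[symmetric] power2_eq_square power4_eq_xxxx mult.assoc)
  moreover have "ennreal (l\<^sup>2) * ennreal (V / l\<^sup>2) = ennreal V"
    using \<open>0 < l\<close> \<open>0 \<le> V\<close> by (simp add: ennreal_mult[symmetric])
  ultimately show ?thesis by (simp add: mult.assoc[symmetric] A_def)
qed

section \<open>Dyadic summation over the levels\<close>

lemma dyadic_level:
  fixes d t :: real
  assumes "0 < d" "d \<le> t"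
  obtains i :: nat where "2^i * d \<le> t" "t < 2 * (2^i * d)"
proof -
  obtain n :: nat where "t / d < 2 ^ n" using real_arch_pow[of 2 "t / d"] by auto
  then have ex: "\<exists>n. t < 2^n * d" using assms by (auto simp: divide_less_eq)
  define N where "N = (LEAST n. t < 2^n * d)"
  have N: "t < 2^N * d" unfolding N_def by (rule LeastI_ex[OF ex])
  have "N \<noteq> 0" using N assms by (metis linorder_not_less lambda_one power_0)
  then obtain i where i: "N = Suc i" using not0_implies_Suc by blast
  have "\<not> t < 2^i * d" using not_less_Least[of i "\<lambda>n. t < 2^n * d"] i by (auto simp: N_def)
  with N show ?thesis by (intro that[of i]) (auto simp: i)
qed

text \<open>
  The bands \<open>A i\<close> between the levels \<open>2^i * d\<close> and \<open>2^(i+1) * d\<close> are disjoint, so the energies in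
  them sum to at most the total energy, while the weights \<open>l^4\<close> of \<open>level_set_energy_bound\<close> are
  exactly those by which the level sets build up the integral of \<open>F^4\<close>. Starting the levels at a
  positive \<open>d\<close> lets them be indexed by the natural numbers; \<open>L4_bound_C1\<close> removes it.
\<close>
lemma L4_bound_above_level:
  fixes F G1 G2 :: "real^2 \<Rightarrow> real"
  assumes F: "F \<in> borel_measurable borel"
    and G: "continuous_on UNIV G1" "continuous_on UNIV G2"
    and d1: "\<And>x y. ((\<lambda>s. F (vector [s, y])) has_real_derivative G1 (vector [x, y])) (at x)"
    and d2: "\<And>x y. ((\<lambda>s. F (vector [x, s])) has_real_derivative G2 (vector [x, y])) (at y)"
    and V: "\<And>l. 0 < l \<Longrightarrow> emeasure lborel {p. l < \<bar>F p\<bar>} \<le> ennreal (V / l\<^sup>2)" and "0 \<le> V"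
    and "0 < d"
  shows "(\<integral>\<^sup>+p. ennreal (F p ^ 4) * indicator {p. 2 * d \<le> \<bar>F p\<bar>} p \<partial>lborel)
    \<le> ennreal (256 * V) * (\<integral>\<^sup>+p. ennreal ((G1 p)\<^sup>2 + (G2 p)\<^sup>2) \<partial>lborel)"
proof -
  note F[measurable]
  have [measurable]: "G1 \<in> borel_measurable borel" "G2 \<in> borel_measurable borel"
    using G borel_measurable_continuous_onI by blast+
  define l where "l i = 2^i * d" for i :: nat
  have l: "0 < l i" for i using \<open>0 < d\<close> by (simp add: l_def)
  define A where "A i = {p. l i < \<bar>F p\<bar> \<and> \<bar>F p\<bar> < 2 * l i}" for i
  have [measurable]: "A i \<in> sets borel" for i unfolding A_def by measurable
  have "disjoint_family A"
    unfolding disjoint_family_on_def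
  proof (intro ballI impI)
    have *: "A m \<inter> A n = {}" if "m < n" for m n
    proof -
      have "2 * l m \<le> l n" using power_increasing[of "Suc m" n "2::real"] that \<open>0 < d\<close>
        by (simp add: l_def)
      then show ?thesis by (auto simp: A_def)
    qed
    fix m n :: nat assume "m \<noteq> n"
    then show "A m \<inter> A n = {}" using *[of m n] *[of n m] by (cases "m < n") auto
  qed
  have "(\<integral>\<^sup>+p. ennreal (F p ^ 4) * indicator {p. 2 * d \<le> \<bar>F p\<bar>} p \<partial>lborel)
    \<le> (\<integral>\<^sup>+p. (\<Sum>i. ennreal (256 * l i ^ 4) * indicator {p. 2 * l i \<le> \<bar>F p\<bar>} p) \<partial>lborel)"
  proof (rule nn_integral_mono)
    fix p
    show "ennreal (F p ^ 4) * indicator {p. 2 * d \<le> \<bar>F p\<bar>} p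
      \<le> (\<Sum>i. ennreal (256 * l i ^ 4) * indicator {p. 2 * l i \<le> \<bar>F p\<bar>} p)"
    proof (cases "2 * d \<le> \<bar>F p\<bar>")
      case True
      obtain i :: nat where i': "2 ^ i * (2 * d) \<le> \<bar>F p\<bar>" "\<bar>F p\<bar> < 2 * (2 ^ i * (2 * d))"
        by (rule dyadic_level[of "2 * d" "\<bar>F p\<bar>"]) (use True \<open>0 < d\<close> in auto)
      then have i: "2 * l i \<le> \<bar>F p\<bar>" "\<bar>F p\<bar> < 4 * l i" by (auto simp: l_def)
      have "F p ^ 4 = \<bar>F p\<bar> ^ 4" by simp
      also have "\<dots> \<le> (4 * l i) ^ 4" using i by (intro power_mono) auto
      finally have "ennreal (F p ^ 4) * indicator {p. 2 * d \<le> \<bar>F p\<bar>} p 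
         \<le> ennreal (256 * l i ^ 4) * indicator {p. 2 * l i \<le> \<bar>F p\<bar>} p"
        using True i by (auto intro: ennreal_leI simp: power_mult_distrib)
      also have "\<dots> \<le> (\<Sum>i. ennreal (256 * l i ^ 4) * indicator {p. 2 * l i \<le> \<bar>F p\<bar>} p)"
        using sum_le_suminf[of "\<lambda>i. ennreal (256 * l i ^ 4) * indicator {p. 2 * l i \<le> \<bar>F p\<bar>} p" "{i}"]
        by (simp del: sum_mult_indicator)
      finally show ?thesis .
    qed auto
  qed
  also have "\<dots> = (\<Sum>i. ennreal 256 * (ennreal (l i ^ 4) * emeasure lborel {p. 2 * l i \<le> \<bar>F p\<bar>}))"
    using l by (subst nn_integral_suminf)
      (auto simp: nn_integral_cmult ennreal_mult mult.assoc less_imp_le)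
  also have "\<dots> \<le> (\<Sum>i. ennreal 256 * (ennreal V * (\<integral>\<^sup>+p. ennreal ((G1 p)\<^sup>2 + (G2 p)\<^sup>2) * indicator (A i) p \<partial>lborel)))"
  proof (rule suminf_le)
    fix i
    show "ennreal 256 * (ennreal (l i ^ 4) * emeasure lborel {p. 2 * l i \<le> \<bar>F p\<bar>})
      \<le> ennreal 256 * (ennreal V * (\<integral>\<^sup>+p. ennreal ((G1 p)\<^sup>2 + (G2 p)\<^sup>2) * indicator (A i) p \<partial>lborel))"
      unfolding A_def
      by (rule mult_left_mono[OF level_set_energy_bound[OF F G d1 d2 l V[OF l] \<open>0 \<le> V\<close>]]) simp
  qed auto
  also have "\<dots> = ennreal (256 * V) * (\<Sum>i. \<integral>\<^sup>+p. ennreal ((G1 p)\<^sup>2 + (G2 p)\<^sup>2) * indicator (A i) p \<partial>lborel)"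
    using \<open>0 \<le> V\<close> by (simp add: ennreal_mult mult.assoc)
  also have "(\<Sum>i. \<integral>\<^sup>+p. ennreal ((G1 p)\<^sup>2 + (G2 p)\<^sup>2) * indicator (A i) p \<partial>lborel)
     = (\<integral>\<^sup>+p. ennreal ((G1 p)\<^sup>2 + (G2 p)\<^sup>2) * (\<Sum>i. indicator (A i) p) \<partial>lborel)"
    by (subst nn_integral_suminf[symmetric]) auto
  also have "\<dots> \<le> (\<integral>\<^sup>+p. ennreal ((G1 p)\<^sup>2 + (G2 p)\<^sup>2) * 1 \<partial>lborel)"
  proof (intro nn_integral_mono mult_left_mono)
    fix p
    have "(\<Sum>i. indicator (A i) p) = (indicator (\<Union>i. A i) p :: ennreal)"
      by (rule suminf_indicator) fact
    then show "(\<Sum>i. indicator (A i) p) \<le> (1::ennreal)" by (simp add: indicator_def)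
  qed auto
  finally show ?thesis by (simp add: mult_left_mono)
qed

lemma L4_bound_C1:
  fixes F G1 G2 :: "real^2 \<Rightarrow> real"
  assumes F: "F \<in> borel_measurable borel"
    and G: "continuous_on UNIV G1" "continuous_on UNIV G2"
    and d1: "\<And>x y. ((\<lambda>s. F (vector [s, y])) has_real_derivative G1 (vector [x, y])) (at x)"
    and d2: "\<And>x y. ((\<lambda>s. F (vector [x, s])) has_real_derivative G2 (vector [x, y])) (at y)"
    and V: "\<And>l. 0 < l \<Longrightarrow> emeasure lborel {p. l < \<bar>F p\<bar>} \<le> ennreal (V / l\<^sup>2)" and "0 \<le> V"
  shows "(\<integral>\<^sup>+p. ennreal (F p ^ 4) \<partial>lborel)
    \<le> ennreal (256 * V) * (\<integral>\<^sup>+p. ennreal ((G1 p)\<^sup>2 + (G2 p)\<^sup>2) \<partial>lborel)" (is "_ \<le> ?K")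
proof -
  note F[measurable]
  define w where "w n p = ennreal (F p ^ 4) * indicator {p. 2 * inverse (real (Suc n)) \<le> \<bar>F p\<bar>} p" for n p
  have [measurable]: "w n \<in> borel_measurable lborel" for n unfolding w_def by measurable
  have lim: "(\<lambda>n. w n p) \<longlonglongrightarrow> ennreal (F p ^ 4)" for p
  proof -
    have "(\<lambda>n. 2 * inverse (real (Suc n))) \<longlonglongrightarrow> 2 * 0"
      by (intro tendsto_intros LIMSEQ_inverse_real_of_nat)
    then have "F p \<noteq> 0 \<Longrightarrow> \<forall>\<^sub>F n in sequentially. 2 * inverse (real (Suc n)) < \<bar>F p\<bar>"
      by (intro order_tendstoD(2)[of _ "2 * 0"]) (auto simp del: of_nat_Suc)
    then have "\<forall>\<^sub>F n in sequentially. w n p = ennreal (F p ^ 4)"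
      by (cases "F p = 0") (auto simp: w_def elim!: eventually_mono)
    then show "(\<lambda>n. w n p) \<longlonglongrightarrow> ennreal (F p ^ 4)" by (rule tendsto_eventually)
  qed
  have "(\<integral>\<^sup>+p. w n p \<partial>lborel) \<le> ?K" for n
    unfolding w_def by (rule L4_bound_above_level[OF F G d1 d2 V \<open>0 \<le> V\<close>]) auto
  then show ?thesis
    by (rule nn_integral_le_of_AE_tendsto[rotated 2]) (auto intro: lim)
qed

section \<open>Smooth bumps\<close>

lemma Ck_Suc_imp: "Ck (Suc k) u \<Longrightarrow> Ck k u"
proof (induction k arbitrary: u)
  case 0
  then show ?case
    by (auto intro!: differentiable_imp_continuous_on simp: differentiable_on_def
        intro: differentiable_at_withinI)
next
  case (Suc k)
  then show ?case by auto
qed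

lemma Ck_const: "Ck k (\<lambda>x. c)"
  by (induction k arbitrary: c) (auto simp: frechet_derivative_const)

lemma Ck_add: "Ck k u \<Longrightarrow> Ck k v \<Longrightarrow> Ck k (\<lambda>x. u x + v x)"
proof (induction k arbitrary: u v)
  case 0 then show ?case by (auto intro: continuous_intros)
next
  case (Suc k)
  have "frechet_derivative (\<lambda>x. u x + v x) (at x)
      = (\<lambda>i. frechet_derivative u (at x) i + frechet_derivative v (at x) i)" for x
    using Suc.prems
    by (intro frechet_derivative_at[symmetric] has_derivative_add)
       (auto simp: frechet_derivative_works[symmetric])
  with Suc show ?case by auto
qed

lemma Ck_mult: "Ck k u \<Longrightarrow> Ck k v \<Longrightarrow> Ck k (\<lambda>x. u x * v x)"
proof (induction k arbitrary: u v)
  case 0 then show ?case by (auto intro: continuous_intros)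
next
  case (Suc k)
  have "frechet_derivative (\<lambda>x. u x * v x) (at x)
      = (\<lambda>i. u x * frechet_derivative v (at x) i + frechet_derivative u (at x) i * v x)" for x
    using Suc.prems
    by (intro frechet_derivative_at[symmetric] has_derivative_mult)
       (auto simp: frechet_derivative_works[symmetric])
  with Suc Ck_Suc_imp[of k u] Ck_Suc_imp[of k v] show ?case by (auto intro!: Ck_add)
qed

lemma Ck_prod: "(\<And>i. i \<in> I \<Longrightarrow> Ck k (u i)) \<Longrightarrow> Ck k (\<lambda>x. \<Prod>i\<in>I. u i x)"
  by (induction I rule: infinite_finite_induct) (auto intro: Ck_const Ck_mult)

text \<open>
  The classical function \<open>exp (-1/t)\<close> for \<open>p = 1\<close>; the polynomial factor makes the family closed
  under differentiation.
\<close>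
definition flat_exp :: "real poly \<Rightarrow> real \<Rightarrow> real" where
  "flat_exp p t = (if t > 0 then poly p (1 / t) * exp (- (1 / t)) else 0)"

lemma poly_exp_minus_tendsto_0: "((\<lambda>s::real. poly p s * exp (- s)) \<longlongrightarrow> 0) at_top"
proof -
  have "((\<lambda>s::real. \<Sum>i\<le>degree p. coeff p i * (s ^ i / exp s)) \<longlongrightarrow> (\<Sum>i\<le>degree p. coeff p i * 0)) at_top"
    by (intro tendsto_intros tendsto_power_div_exp_0)
  moreover have "poly p s * exp (- s) = (\<Sum>i\<le>degree p. coeff p i * (s ^ i / exp s))" for s
    by (simp add: poly_altdef sum_distrib_right exp_minus divide_inverse mult.assoc)
  ultimately show ?thesis by simp
qed

lemma flat_exp_has_derivative:
  "(flat_exp p has_real_derivative flat_exp ([:0, 0, 1:] * (p - pderiv p)) t) (at t)"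
proof -
  consider "t > 0" | "t < 0" | "t = 0" by linarith
  then show ?thesis
  proof cases
    case 1
    have "((\<lambda>t. poly p (1 / t) * exp (- (1 / t))) has_real_derivative
        flat_exp ([:0, 0, 1:] * (p - pderiv p)) t) (at t)"
      using 1 by (auto intro!: derivative_eq_intros DERIV_chain2[OF poly_DERIV] 
        simp: flat_exp_def field_simps power2_eq_square)
    then show ?thesis
      by (rule has_field_derivative_transform_within_open[where S = "{0<..}"])
         (use 1 in \<open>auto simp: flat_exp_def\<close>)
  next
    case 2
    have "((\<lambda>t. 0) has_real_derivative flat_exp ([:0, 0, 1:] * (p - pderiv p)) t) (at t)"
      using 2 by (auto simp: flat_exp_def)
    then show ?thesis
      by (rule has_field_derivative_transform_within_open[where S = "{..<0}"])
         (use 2 in \<open>auto simp: flat_exp_def\<close>)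
  next
    case 3
    have "((\<lambda>s. poly ([:0, 1:] * p) s * exp (- s)) \<longlongrightarrow> 0) at_top"
      by (rule poly_exp_minus_tendsto_0)
    then have "((\<lambda>t. poly ([:0, 1:] * p) (inverse t) * exp (- inverse t)) \<longlongrightarrow> 0) (at_right 0)"
      by (rule filterlim_compose[OF _ filterlim_inverse_at_top_right])
    then have r: "((\<lambda>t. flat_exp p t / t) \<longlongrightarrow> 0) (at_right 0)"
      by (rule tendsto_cong[THEN iffD1, rotated])
         (auto simp: flat_exp_def eventually_at_filter field_simps intro!: always_eventually)
    have l: "((\<lambda>t. flat_exp p t / t) \<longlongrightarrow> 0) (at_left 0)"
      by (rule tendsto_eventually)
         (auto simp: flat_exp_def eventually_at_filter)
    have "((\<lambda>t. flat_exp p t / t) \<longlongrightarrow> 0) (at 0)"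
      using l r by (rule filterlim_split_at)
    then show ?thesis using 3 by (simp add: DERIV_def flat_exp_def)
  qed
qed

text \<open>
  The derivative of \<open>flat_exp p\<close> is \<open>flat_exp q\<close> for another polynomial \<open>q\<close>, so the induction
  closes once \<open>p\<close> is arbitrary.
\<close>
lemma Ck_flat_exp: "Ck k (\<lambda>x::'a::euclidean_space. flat_exp p (c + x \<bullet> v))"
proof (induction k arbitrary: p)
  case 0
  have "continuous_on UNIV (flat_exp p)"
    using flat_exp_has_derivative by (meson DERIV_isCont continuous_at_imp_continuous_on)
  then show ?case
    by (auto intro!: continuous_on_compose2[of UNIV "flat_exp p"] continuous_intros)
next
  case (Suc k)
  have d: "((\<lambda>x::'a. flat_exp p (c + x \<bullet> v)) has_derivative
     (\<lambda>i. flat_exp ([:0, 0, 1:] * (p - pderiv p)) (c + x \<bullet> v) * (i \<bullet> v))) (at x)" for x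
  proof -
    have "((\<lambda>x::'a. c + x \<bullet> v) has_derivative (\<lambda>i. i \<bullet> v)) (at x)"
      by (auto intro!: derivative_eq_intros)
    from has_derivative_compose[OF this flat_exp_has_derivative[of p, unfolded has_field_derivative_def]]
    show ?thesis by simp
  qed
  show ?case
    unfolding Ck.simps frechet_derivative_at[OF d, symmetric]
    using d by (auto intro!: Ck_mult Ck_const Suc simp: differentiable_def)
qed

text \<open>
  A product of one factor for each face of the box. The first argument \<open>m\<close> sharpens the bump: as
  \<open>m \<rightarrow> \<infinity>\<close> it converges to the indicator of the open box with side \<open>h\<close>, from below.
\<close>
definition bump :: "real \<Rightarrow> real \<Rightarrow> 'a::euclidean_space \<Rightarrow> real" where
  "bump m h y = (\<Prod>b\<in>Basis. flat_exp 1 (m * (y \<bullet> b)) * flat_exp 1 (m * (h - y \<bullet> b)))"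

lemma flat_exp_1_bounds: "0 \<le> flat_exp 1 t" "flat_exp 1 t \<le> 1"
  by (auto simp: flat_exp_def)

lemma bump_nonneg: "0 \<le> bump m h y"
  unfolding bump_def by (intro prod_nonneg) (auto simp: flat_exp_1_bounds)

lemma bump_le_1: "bump m h y \<le> 1"
  unfolding bump_def
  by (intro prod_le_1) (auto simp: flat_exp_1_bounds intro!: mult_nonneg_nonneg mult_le_one)

lemma bump_eq_0:
  assumes "0 < m" "y \<notin> box 0 (h *\<^sub>R One)"
  shows "bump m h y = 0"
proof -
  obtain b where "b \<in> Basis" "y \<bullet> b \<le> 0 \<or> h \<le> y \<bullet> b"
    using assms(2) by (auto simp: mem_box not_less)
  with \<open>0 < m\<close> show ?thesis
    unfolding bump_def
    by (intro prod_zero[OF finite_Basis] bexI[of _ b])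
       (auto simp: flat_exp_def not_less mult_le_0_iff zero_less_mult_iff)
qed

lemma bump_tendsto:
  "(\<lambda>n. bump (real (Suc n)) h y) \<longlonglongrightarrow> indicator (box 0 (h *\<^sub>R One)) y"
proof (cases "y \<in> box 0 (h *\<^sub>R One)")
  case True
  have *: "(\<lambda>n. flat_exp 1 (real (Suc n) * t)) \<longlonglongrightarrow> 1" if "0 < t" for t
  proof -
    have "(\<lambda>n. exp (- (inverse (real (Suc n)) * inverse t))) \<longlonglongrightarrow> exp (- (0 * inverse t))"
      by (intro tendsto_intros LIMSEQ_inverse_real_of_nat)
    moreover have "flat_exp 1 (real (Suc n) * t) = exp (- (inverse (real (Suc n)) * inverse t))" for n
      using that by (simp add: flat_exp_def divide_inverse zero_less_mult_iff add_pos_nonneg)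
    ultimately show ?thesis by simp
  qed
  have "(\<lambda>n. bump (real (Suc n)) h y) \<longlonglongrightarrow> (\<Prod>b\<in>(Basis::'a set). 1 * 1)"
    unfolding bump_def using True
    by (intro tendsto_intros *) (auto simp: mem_box)
  with True show ?thesis by simp
next
  case False
  then show ?thesis by (simp add: bump_eq_0)
qed

lemma bump_test_function:
  fixes x :: "'a::euclidean_space"
  assumes "0 < m"
  shows "(\<lambda>y. bump m h (y - x)) \<in> test_functions UNIV"
proof -
  have "Ck k (\<lambda>y. bump m h (y - x))" for k
  proof -
    have "bump m h (y - x) = (\<Prod>b\<in>Basis. flat_exp 1 (- (m * (x \<bullet> b)) + y \<bullet> (m *\<^sub>R b)) *
        flat_exp 1 (m * h + m * (x \<bullet> b) + y \<bullet> (- m *\<^sub>R b)))" for y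
      unfolding bump_def by (simp add: inner_diff_left algebra_simps)
    then show ?thesis by (simp only:) (intro Ck_prod Ck_mult Ck_flat_exp)
  qed
  moreover have "{y. bump m h (y - x) \<noteq> 0} \<subseteq> (+) x ` box 0 (h *\<^sub>R One)"
  proof
    fix y assume "y \<in> {y. bump m h (y - x) \<noteq> 0}"
    then have "y - x \<in> box 0 (h *\<^sub>R One)" using bump_eq_0[OF assms] by blast
    then show "y \<in> (+) x ` box 0 (h *\<^sub>R One)" by (intro image_eqI[of _ _ "y - x"]) auto
  qed
  then have "bounded {y. bump m h (y - x) \<noteq> 0}"
    by (rule bounded_subset[rotated]) (intro bounded_translation bounded_box)
  ultimately show ?thesis by (auto simp: test_functions_def)
qed

section \<open>Mollification\<close>

text \<open>
  Local integrability for Borel functions with respect to Lebesgue-Borel measure. Mollification is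
  carried out for Borel representatives because Tonelli's theorem below is about products of Borel
  measures.
\<close>
definition loc_integrable :: "('a::euclidean_space \<Rightarrow> real) \<Rightarrow> bool" where
  "loc_integrable f \<longleftrightarrow> f \<in> borel_measurable borel \<and> (\<forall>a b. set_integrable lborel (cbox a b) f)"

lemma nn_integral_lborel_reflect:
  fixes w :: "'a::euclidean_space \<Rightarrow> ennreal"
  assumes [measurable]: "w \<in> borel_measurable borel"
  shows "(\<integral>\<^sup>+x. w (c - x) \<partial>lborel) = (\<integral>\<^sup>+x. w x \<partial>lborel)"
proof -
  have "lborel = density (distr lborel borel (\<lambda>x::'a. c + (-1) *\<^sub>R x)) (\<lambda>_. \<bar>-1::real\<bar> ^ DIM('a))"
    by (rule lborel_affine) simp
  then have "lborel = distr lborel borel (\<lambda>x::'a. c - x)"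
    by (simp add: density_1)
  then have "(\<integral>\<^sup>+x. w x \<partial>lborel) = (\<integral>\<^sup>+x. w x \<partial>distr lborel borel (\<lambda>x::'a. c - x))"
    by simp
  also have "\<dots> = (\<integral>\<^sup>+x. w (c - x) \<partial>lborel)"
    by (subst nn_integral_distr) auto
  finally show ?thesis by simp
qed

lemma nn_integral_lborel_shift:
  fixes w :: "'a::euclidean_space \<Rightarrow> ennreal"
  assumes [measurable]: "w \<in> borel_measurable borel"
  shows "(\<integral>\<^sup>+x. w (x - c) \<partial>lborel) = (\<integral>\<^sup>+x. w x \<partial>lborel)"
proof -
  have "(\<integral>\<^sup>+x. w x \<partial>lborel) = (\<integral>\<^sup>+x. w x \<partial>distr lborel borel ((+) (- c)))"
    by (simp add: lborel_distr_plus)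
  also have "\<dots> = (\<integral>\<^sup>+x. w (x - c) \<partial>lborel)"
    by (subst nn_integral_distr) auto
  finally show ?thesis by simp
qed

locale mollifier =
  fixes \<eta> :: "'a::euclidean_space \<Rightarrow> real" and K :: "'a set"
  assumes cont: "continuous_on UNIV \<eta>"
    and nonneg: "0 \<le> \<eta> x"
    and mass: "(\<integral>\<^sup>+x. ennreal (\<eta> x) \<partial>lborel) \<le> 1"
    and K: "compact K"
    and outside: "x \<notin> K \<Longrightarrow> \<eta> x = 0"
begin

definition mollify :: "('a \<Rightarrow> real) \<Rightarrow> 'a \<Rightarrow> real" where
  "mollify f x = (\<integral>y. f y * \<eta> (y - x) \<partial>lborel)"

lemma measurable_kernel [measurable]: "\<eta> \<in> borel_measurable borel"
  using cont by (rule borel_measurable_continuous_onI)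

lemma mass_shift: "(\<integral>\<^sup>+y. ennreal (\<eta> (y - x)) \<partial>lborel) \<le> 1"
  using nn_integral_lborel_shift[of "\<lambda>y. ennreal (\<eta> y)" x] mass by simp

lemma kernel_bounded: obtains M where "0 \<le> M" "\<And>y. \<eta> y \<le> M"
proof -
  have "bounded (\<eta> ` K)"
    using K cont by (intro compact_imp_bounded compact_continuous_image continuous_on_subset[OF cont]) auto
  then obtain M where "0 < M" "\<And>y. y \<in> K \<Longrightarrow> norm (\<eta> y) \<le> M"
    by (auto simp: bounded_pos)
  then show ?thesis using outside by (intro that[of M]) (metis less_imp_le norm_zero real_norm_def abs_le_D1 order.trans)+
qed

text \<open>
  One dominating function must serve for all translates of the kernel that occur in a convergent
  sequence.
\<close>
lemma uniform_support:
  assumes "bounded B"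
  obtains c d where "\<And>x y. x \<in> B \<Longrightarrow> y - x \<in> K \<Longrightarrow> y \<in> cbox c d"
proof -
  have "bounded (\<Union>x\<in>B. \<Union>z\<in>K. {x + z})"
    using assms compact_imp_bounded[OF K] by (rule bounded_sums)
  then obtain c where c: "(\<Union>x\<in>B. \<Union>z\<in>K. {x + z}) \<subseteq> cbox (- c) c"
    using bounded_subset_cbox_symmetric by blast
  show ?thesis
  proof (rule that[of "- c" c])
    fix x y assume "x \<in> B" "y - x \<in> K"
    then have "x + (y - x) \<in> (\<Union>x\<in>B. \<Union>z\<in>K. {x + z})" by blast
    then show "y \<in> cbox (- c) c" using c by auto
  qed
qed

lemma mollify_integrable:
  assumes f: "loc_integrable f"
  shows "integrable lborel (\<lambda>y. f y * \<eta> (y - x))"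
proof -
  obtain M where M: "0 \<le> M" "\<And>y. \<eta> y \<le> M" by (rule kernel_bounded) blast
  obtain c d where cd: "\<And>y. y - x \<in> K \<Longrightarrow> y \<in> cbox c d"
    using uniform_support[of "{x}"] by (metis bounded_insert bounded_empty insertI1)
  have [measurable]: "f \<in> borel_measurable borel" using f by (simp add: loc_integrable_def)
  have "integrable lborel (\<lambda>y. M * (indicator (cbox c d) y *\<^sub>R f y))"
    using f by (intro integrable_mult_right) (auto simp: loc_integrable_def set_integrable_def)
  then show ?thesis
  proof (rule Bochner_Integration.integrable_bound)
    show "AE y in lborel. norm (f y * \<eta> (y - x)) \<le> norm (M * (indicator (cbox c d) y *\<^sub>R f y))"
    proof (intro AE_I2)
      fix y
      show "norm (f y * \<eta> (y - x)) \<le> norm (M * (indicator (cbox c d) y *\<^sub>R f y))"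
      proof (cases "y - x \<in> K")
        case True
        have "\<bar>f y\<bar> * \<eta> (y - x) \<le> \<bar>f y\<bar> * M" using M by (intro mult_left_mono) auto
        then show ?thesis using cd[OF True] M nonneg by (simp add: abs_mult mult.commute)
      qed (simp add: outside)
    qed
  qed measurable
qed

lemma continuous_mollify:
  assumes f: "loc_integrable f"
  shows "continuous_on UNIV (mollify f)"
proof -
  obtain M where M: "0 \<le> M" "\<And>y. \<eta> y \<le> M" by (rule kernel_bounded) blast
  have [measurable]: "f \<in> borel_measurable borel" using f by (simp add: loc_integrable_def)
  have "(\<lambda>n. mollify f (X n)) \<longlonglongrightarrow> mollify f x" if X: "X \<longlonglongrightarrow> x" for X :: "nat \<Rightarrow> 'a" and x
  proof -
    have "bounded (range X)" using X by (rule convergent_imp_bounded)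
    then obtain c d where cd: "\<And>n y. y - X n \<in> K \<Longrightarrow> y \<in> cbox c d"
      using uniform_support[of "range X"] by (metis rangeI)
    show ?thesis
      unfolding mollify_def
    proof (rule integral_dominated_convergence)
      show "integrable lborel (\<lambda>y. M * norm (indicator (cbox c d) y *\<^sub>R f y))"
        using f by (intro integrable_mult_right integrable_norm) (auto simp: loc_integrable_def set_integrable_def)
      show "AE y in lborel. (\<lambda>n. f y * \<eta> (y - X n)) \<longlonglongrightarrow> f y * \<eta> (y - x)"
      proof (intro AE_I2 tendsto_intros)
        fix y
        have "isCont \<eta> (y - x)" using cont by (simp add: continuous_on_eq_continuous_at)
        then show "(\<lambda>n. \<eta> (y - X n)) \<longlonglongrightarrow> \<eta> (y - x)"
          by (rule isCont_tendsto_compose) (intro tendsto_intros X)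
      qed
      show "AE y in lborel. norm (f y * \<eta> (y - X n)) \<le> M * norm (indicator (cbox c d) y *\<^sub>R f y)" for n
      proof (intro AE_I2)
        fix y
        show "norm (f y * \<eta> (y - X n)) \<le> M * norm (indicator (cbox c d) y *\<^sub>R f y)"
        proof (cases "y - X n \<in> K")
          case True
          have "\<bar>f y\<bar> * \<eta> (y - X n) \<le> \<bar>f y\<bar> * M" using M by (intro mult_left_mono) auto
          then show ?thesis using cd[OF True] M nonneg by (simp add: abs_mult mult.commute)
        qed (simp add: outside M)
      qed
    qed measurable
  qed
  then show ?thesis
    by (auto simp: continuous_on_sequentially o_def)
qed

text \<open>
  Differentiation under the integral puts \<open>- \<eta>'\<close> on the kernel, and the integration by parts that
  defines the weak derivative \<open>g\<close> moves it back: mollification commutes with weak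
  differentiation. The kernel being Lipschitz along \<open>e\<close> dominates the difference quotients.
\<close>
lemma mollify_has_derivative:
  assumes f: "loc_integrable f"
    and der: "\<And>y t. ((\<lambda>t. \<eta> (y + t *\<^sub>R e)) has_real_derivative \<eta>' (y + t *\<^sub>R e)) (at t)"
    and bnd: "\<And>y. \<bar>\<eta>' y\<bar> \<le> M" 
    and parts: "(\<integral>y. f y * \<eta>' (y - x) \<partial>lborel) = - (\<integral>y. g y * \<eta> (y - x) \<partial>lborel)"
  shows "((\<lambda>t. mollify f (x + t *\<^sub>R e)) has_real_derivative mollify g x) (at 0)"
proof -
  have [measurable]: "f \<in> borel_measurable borel" using f by (simp add: loc_integrable_def)
  have M0: "0 \<le> M" using bnd[of 0] by linarith
  have lip: "\<bar>\<eta> (y + t *\<^sub>R e) - \<eta> y\<bar> \<le> M * \<bar>t\<bar>" for y t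
    using field_differentiable_bound[of UNIV "\<lambda>t. \<eta> (y + t *\<^sub>R e)" "\<lambda>t. \<eta>' (y + t *\<^sub>R e)" M t 0]
      der bnd by simp
  have "(\<lambda>n. (mollify f (x + H n *\<^sub>R e) - mollify f x) / H n) \<longlonglongrightarrow> mollify g x"
    if H: "H \<longlonglongrightarrow> 0" "\<And>n. H n \<noteq> 0" for H :: "nat \<Rightarrow> real"
  proof -
    define X where "X n = x + H n *\<^sub>R e" for n
    have "X \<longlonglongrightarrow> x + 0 *\<^sub>R e" unfolding X_def by (intro tendsto_intros H)
    then have "bounded (insert x (range X))" using convergent_imp_bounded by (simp add: bounded_insert) blast
    then obtain c d where cd: "\<And>z y. z \<in> insert x (range X) \<Longrightarrow> y - z \<in> K \<Longrightarrow> y \<in> cbox c d"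
      using uniform_support by metis
    have "(\<lambda>n. \<integral>y. f y * ((\<eta> (y - X n) - \<eta> (y - x)) / H n) \<partial>lborel) \<longlonglongrightarrow> (\<integral>y. f y * (- \<eta>' (y - x)) \<partial>lborel)"
    proof (rule integral_dominated_convergence)
      show "integrable lborel (\<lambda>y. M * norm (indicator (cbox c d) y *\<^sub>R f y))"
        using f by (intro integrable_mult_right integrable_norm) (auto simp: loc_integrable_def set_integrable_def)
      have lim: "(\<lambda>n. (\<eta> (y - X n) - \<eta> (y - x)) / H n) \<longlonglongrightarrow> - \<eta>' (y - x)" for y
      proof -
        have "((\<lambda>t. (\<eta> (y - x + t *\<^sub>R e) - \<eta> (y - x)) / t) \<longlongrightarrow> \<eta>' (y - x)) (at 0)"
          using der[of "y - x" 0] by (simp add: DERIV_def)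
        then have "((\<lambda>t. (\<eta> (y - x + t *\<^sub>R e) - \<eta> (y - x)) / t) \<circ> (\<lambda>n. - H n)) \<longlonglongrightarrow> \<eta>' (y - x)"
          unfolding tendsto_at_iff_sequentially using H
          by (auto dest!: spec[of _ "\<lambda>n. - H n"] intro: tendsto_minus[where a = 0, simplified])
        from tendsto_minus[OF this] show ?thesis
          by (simp add: o_def X_def algebra_simps)
      qed
      then show "AE y in lborel. (\<lambda>n. f y * ((\<eta> (y - X n) - \<eta> (y - x)) / H n)) \<longlonglongrightarrow> f y * (- \<eta>' (y - x))"
        by (intro AE_I2 tendsto_mult_left) 
      have "(\<lambda>y. \<eta>' (y - x)) \<in> borel_measurable lborel"
      proof -
        have "(\<lambda>y. - \<eta>' (y - x)) \<in> borel_measurable lborel"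
          by (rule borel_measurable_LIMSEQ_real[OF lim]) measurable
        then show ?thesis by (simp add: borel_measurable_uminus_eq)
      qed
      then show "(\<lambda>y. f y * (- \<eta>' (y - x))) \<in> borel_measurable lborel" by measurable
      show "AE y in lborel. norm (f y * ((\<eta> (y - X n) - \<eta> (y - x)) / H n)) \<le> M * norm (indicator (cbox c d) y *\<^sub>R f y)" for n
      proof (intro AE_I2)
        fix y
        show "norm (f y * ((\<eta> (y - X n) - \<eta> (y - x)) / H n)) \<le> M * norm (indicator (cbox c d) y *\<^sub>R f y)"
        proof (cases "y \<in> cbox c d")
          case True
          have "\<bar>(\<eta> (y - X n) - \<eta> (y - x)) / H n\<bar> \<le> M"
            using lip[of "y - x" "- H n"] H(2)[of n]
            by (simp add: X_def abs_divide divide_le_eq algebra_simps)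
          then have "\<bar>f y\<bar> * \<bar>(\<eta> (y - X n) - \<eta> (y - x)) / H n\<bar> \<le> \<bar>f y\<bar> * M"
            by (intro mult_left_mono) auto
          then show ?thesis using True by (simp add: abs_mult mult.commute)
        next
          case False
          then have "y - X n \<notin> K" "y - x \<notin> K" using cd by auto
          then show ?thesis using False by (simp add: outside)
        qed
      qed
    qed measurable
    moreover have "(\<integral>y. f y * ((\<eta> (y - X n) - \<eta> (y - x)) / H n) \<partial>lborel) = (mollify f (X n) - mollify f x) / H n" for n
    proof -
      have "(\<integral>y. f y * ((\<eta> (y - X n) - \<eta> (y - x)) / H n) \<partial>lborel)
         = (\<integral>y. (f y * \<eta> (y - X n) - f y * \<eta> (y - x)) / H n \<partial>lborel)"
        by (simp add: algebra_simps)
      also have "\<dots> = (\<integral>y. f y * \<eta> (y - X n) - f y * \<eta> (y - x) \<partial>lborel) / H n"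
        by simp
      also have "\<dots> = (mollify f (X n) - mollify f x) / H n"
        unfolding mollify_def by (subst Bochner_Integration.integral_diff) (auto intro: mollify_integrable f)
      finally show ?thesis .
    qed
    moreover have "(\<integral>y. f y * (- \<eta>' (y - x)) \<partial>lborel) = mollify g x"
      using parts by (simp add: mollify_def)
    ultimately show ?thesis by (simp only: X_def)
  qed
  then show ?thesis
    by (auto simp: DERIV_def tendsto_at_iff_sequentially o_def)
qed

lemma nn_integral_mollify:
  assumes [measurable]: "w \<in> borel_measurable borel"
  shows "(\<integral>\<^sup>+x. \<integral>\<^sup>+y. w y * ennreal (\<eta> (y - x)) \<partial>lborel \<partial>lborel) \<le> (\<integral>\<^sup>+y. w y \<partial>lborel)"
proof -
  have "(\<integral>\<^sup>+x. \<integral>\<^sup>+y. w y * ennreal (\<eta> (y - x)) \<partial>lborel \<partial>lborel)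
     = (\<integral>\<^sup>+y. \<integral>\<^sup>+x. w y * ennreal (\<eta> (y - x)) \<partial>lborel \<partial>lborel)"
    by (rule lborel_pair.Fubini') measurable
  also have "\<dots> = (\<integral>\<^sup>+y. w y * (\<integral>\<^sup>+x. ennreal (\<eta> (y - x)) \<partial>lborel) \<partial>lborel)"
    by (intro nn_integral_cong nn_integral_cmult) measurable
  also have "\<dots> = (\<integral>\<^sup>+y. w y * (\<integral>\<^sup>+x. ennreal (\<eta> x) \<partial>lborel) \<partial>lborel)"
    by (subst nn_integral_lborel_reflect) auto
  also have "\<dots> \<le> (\<integral>\<^sup>+y. w y * 1 \<partial>lborel)"
    by (intro nn_integral_mono mult_left_mono mass) auto
  finally show ?thesis by simp
qed

lemma abs_mollify_le:
  assumes f: "loc_integrable f"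
  shows "ennreal \<bar>mollify f x\<bar> \<le> (\<integral>\<^sup>+y. ennreal \<bar>f y\<bar> * ennreal (\<eta> (y - x)) \<partial>lborel)"
proof -
  have "ennreal (norm (mollify f x)) \<le> (\<integral>\<^sup>+y. ennreal (norm (f y * \<eta> (y - x))) \<partial>lborel)"
    unfolding mollify_def by (rule integral_norm_bound_ennreal[OF mollify_integrable[OF f]])
  then show ?thesis by (simp add: abs_mult ennreal_mult nonneg)
qed

text \<open>
  Jensen's inequality for the square. The kernel has mass at most 1, so Cauchy-Schwarz bounds the
  square of the average by the average of the square.
\<close>
lemma mollify_energy:
  assumes f: "loc_integrable f"
  shows "(\<integral>\<^sup>+x. ennreal ((mollify f x)\<^sup>2) \<partial>lborel) \<le> (\<integral>\<^sup>+y. ennreal ((f y)\<^sup>2) \<partial>lborel)"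
proof -
  have [measurable]: "f \<in> borel_measurable borel" using f by (simp add: loc_integrable_def)
  have "ennreal ((mollify f x)\<^sup>2) \<le> (\<integral>\<^sup>+y. ennreal ((f y)\<^sup>2) * ennreal (\<eta> (y - x)) \<partial>lborel)" for x
  proof -
    have "ennreal ((mollify f x)\<^sup>2) = (ennreal \<bar>mollify f x\<bar>)\<^sup>2"
      by (simp add: ennreal_power)
    also have "\<dots> \<le> (\<integral>\<^sup>+y. ennreal \<bar>f y\<bar> * ennreal (\<eta> (y - x)) \<partial>lborel)\<^sup>2"
      by (intro power_mono abs_mollify_le f) auto
    also have "\<dots> = (\<integral>\<^sup>+y. ennreal (\<bar>f y\<bar> * sqrt (\<eta> (y - x))) * ennreal (sqrt (\<eta> (y - x))) \<partial>lborel)\<^sup>2"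
      by (simp add: ennreal_mult[symmetric] nonneg mult.assoc)
    also have "\<dots> \<le> (\<integral>\<^sup>+y. (ennreal (\<bar>f y\<bar> * sqrt (\<eta> (y - x))))\<^sup>2 \<partial>lborel) * (\<integral>\<^sup>+y. (ennreal (sqrt (\<eta> (y - x))))\<^sup>2 \<partial>lborel)"
      by (rule Cauchy_Schwarz_nn_integral) measurable
    also have "\<dots> = (\<integral>\<^sup>+y. ennreal ((f y)\<^sup>2) * ennreal (\<eta> (y - x)) \<partial>lborel) * (\<integral>\<^sup>+y. ennreal (\<eta> (y - x)) \<partial>lborel)"
      by (simp add: ennreal_power power_mult_distrib nonneg ennreal_mult)
    also have "\<dots> \<le> (\<integral>\<^sup>+y. ennreal ((f y)\<^sup>2) * ennreal (\<eta> (y - x)) \<partial>lborel) * 1"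
      by (intro mult_left_mono mass_shift) auto
    finally show ?thesis by simp
  qed
  then have "(\<integral>\<^sup>+x. ennreal ((mollify f x)\<^sup>2) \<partial>lborel)
     \<le> (\<integral>\<^sup>+x. \<integral>\<^sup>+y. ennreal ((f y)\<^sup>2) * ennreal (\<eta> (y - x)) \<partial>lborel \<partial>lborel)"
    by (intro nn_integral_mono) auto
  also have "\<dots> \<le> (\<integral>\<^sup>+y. ennreal ((f y)\<^sup>2) \<partial>lborel)"
    by (rule nn_integral_mollify) measurable
  finally show ?thesis .
qed

end

text \<open>
  A bound on the distribution function alone makes the part of \<open>\<bar>f\<bar>\<close> above the level \<open>\<beta>\<close>
  integrable, by summing over the dyadic levels \<open>2^i * \<beta>\<close>. The halved levels serve to keep the
  inequality \<open>l < \<bar>f x\<bar>\<close> strict.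
\<close>
lemma excess_integral_le:
  fixes f :: "'a \<Rightarrow> real"
  assumes [measurable]: "f \<in> borel_measurable M"
    and V: "\<And>l. 0 < l \<Longrightarrow> emeasure M {x \<in> space M. l < \<bar>f x\<bar>} \<le> ennreal (V / l\<^sup>2)" and "0 \<le> V"
    and "0 < \<beta>"
  shows "(\<integral>\<^sup>+x. ennreal (\<bar>f x\<bar> - \<beta>) \<partial>M) \<le> ennreal (16 * V / \<beta>)"
proof -
  define l where "l i = 2^i * \<beta>" for i :: nat
  have l: "0 < l i" for i using \<open>0 < \<beta>\<close> by (simp add: l_def)
  have "(\<integral>\<^sup>+x. ennreal (\<bar>f x\<bar> - \<beta>) \<partial>M)
    \<le> (\<integral>\<^sup>+x. (\<Sum>i. ennreal (2 * l i) * indicator {x \<in> space M. l i / 2 < \<bar>f x\<bar>} x) \<partial>M)"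
  proof (rule nn_integral_mono)
    fix x assume x: "x \<in> space M"
    show "ennreal (\<bar>f x\<bar> - \<beta>) \<le> (\<Sum>i. ennreal (2 * l i) * indicator {x \<in> space M. l i / 2 < \<bar>f x\<bar>} x)"
    proof (cases "\<beta> \<le> \<bar>f x\<bar>")
      case True
      obtain i :: nat where i: "2 ^ i * \<beta> \<le> \<bar>f x\<bar>" "\<bar>f x\<bar> < 2 * (2 ^ i * \<beta>)"
        by (rule dyadic_level[OF \<open>0 < \<beta>\<close> True])
      have "l i / 2 < \<bar>f x\<bar>" using i l[of i] by (simp add: l_def)
      moreover have "ennreal (\<bar>f x\<bar> - \<beta>) \<le> ennreal (2 * l i)"
        using i \<open>0 < \<beta>\<close> by (intro ennreal_leI) (simp add: l_def)
      ultimately have "ennreal (\<bar>f x\<bar> - \<beta>) \<le> ennreal (2 * l i) * indicator {x \<in> space M. l i / 2 < \<bar>f x\<bar>} x"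
        using x by simp
      also have "\<dots> \<le> (\<Sum>i. ennreal (2 * l i) * indicator {x \<in> space M. l i / 2 < \<bar>f x\<bar>} x)"
        using sum_le_suminf[of "\<lambda>i. ennreal (2 * l i) * indicator {x \<in> space M. l i / 2 < \<bar>f x\<bar>} x" "{i}"]
        by (simp del: sum_mult_indicator)
      finally show ?thesis .
    qed (simp add: ennreal_neg)
  qed
  also have "\<dots> = (\<Sum>i. ennreal (2 * l i) * emeasure M {x \<in> space M. l i / 2 < \<bar>f x\<bar>})"
    by (subst nn_integral_suminf) (auto simp: nn_integral_cmult)
  also have "\<dots> \<le> (\<Sum>i. ennreal (16 * V / \<beta> * (1/2)^Suc i))"
  proof (rule suminf_le)
    fix i
    have "ennreal (2 * l i) * emeasure M {x \<in> space M. l i / 2 < \<bar>f x\<bar>} \<le> ennreal (2 * l i) * ennreal (V / (l i / 2)\<^sup>2)"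
      using l[of i] by (intro mult_left_mono V) auto
    also have "\<dots> = ennreal (2 * l i * (V / (l i / 2)\<^sup>2))"
      using l[of i] \<open>0 \<le> V\<close> by (intro ennreal_mult[symmetric]) auto
    also have "2 * l i * (V / (l i / 2)\<^sup>2) = 16 * V / \<beta> * (1/2)^Suc i"
      using l[of i] \<open>0 < \<beta>\<close> by (simp add: l_def field_simps power2_eq_square)
    finally show "ennreal (2 * l i) * emeasure M {x \<in> space M. l i / 2 < \<bar>f x\<bar>} \<le> ennreal (16 * V / \<beta> * (1/2)^Suc i)" .
  qed auto
  also have "\<dots> = ennreal (16 * V / \<beta> * 1)"
  proof -
    have "(\<lambda>i. 16 * V / \<beta> * (1/2)^Suc i) sums (16 * V / \<beta> * 1)"
      by (intro sums_mult power_half_series)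
    then show ?thesis
      using \<open>0 \<le> V\<close> \<open>0 < \<beta>\<close> by (intro suminf_ennreal_eq) auto
  qed
  finally show ?thesis by simp
qed

context mollifier begin

text \<open>
  Mollification preserves weak \<open>L\<^sup>2\<close> up to a constant, although the weak quasi-norm is not convex.
  With \<open>\<beta> = \<alpha> / 2\<close>, the mollification of \<open>\<bar>f\<bar>\<close> is at most \<open>\<beta>\<close> plus that of the excess
  \<open>max 0 (\<bar>f\<bar> - \<beta>)\<close>; so where it exceeds \<open>\<alpha>\<close>, the mollified excess exceeds \<open>\<beta>\<close>, and Markov's
  inequality with \<open>excess_integral_le\<close> applies.
\<close>
lemma mollify_weak_bound:
  assumes f: "loc_integrable f"
    and V: "\<And>l. 0 < l \<Longrightarrow> emeasure lborel {x. l < \<bar>f x\<bar>} \<le> ennreal (V / l\<^sup>2)" and "0 \<le> V"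
    and "0 < \<alpha>"
  shows "emeasure lborel {x. \<alpha> < \<bar>mollify f x\<bar>} \<le> ennreal (64 * V / \<alpha>\<^sup>2)"
proof -
  have [measurable]: "f \<in> borel_measurable borel" using f by (simp add: loc_integrable_def)
  have [measurable]: "mollify f \<in> borel_measurable borel"
    using continuous_mollify[OF f] by (rule borel_measurable_continuous_onI)
  \<comment> \<open>half of the level is left to the bounded part, half to the excess\<close>
  define \<beta> where "\<beta> = \<alpha> / 2"
  have "0 < \<beta>" using \<open>0 < \<alpha>\<close> by (simp add: \<beta>_def)
  define H where "H x = (\<integral>\<^sup>+y. ennreal (\<bar>f y\<bar> - \<beta>) * ennreal (\<eta> (y - x)) \<partial>lborel)" for x
  have [measurable]: "H \<in> borel_measurable borel"
    using lborel.borel_measurable_nn_integral_fst[of "\<lambda>p. ennreal (\<bar>f (snd p)\<bar> - \<beta>) * ennreal (\<eta> (snd p - fst p))" borel]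
    by (simp add: H_def[abs_def])
  have le: "ennreal \<bar>mollify f x\<bar> \<le> ennreal \<beta> + H x" for x
  proof -
    have "ennreal \<bar>mollify f x\<bar> \<le> (\<integral>\<^sup>+y. ennreal \<bar>f y\<bar> * ennreal (\<eta> (y - x)) \<partial>lborel)"
      by (rule abs_mollify_le[OF f])
    also have "\<dots> \<le> (\<integral>\<^sup>+y. ennreal \<beta> * ennreal (\<eta> (y - x)) + ennreal (\<bar>f y\<bar> - \<beta>) * ennreal (\<eta> (y - x)) \<partial>lborel)"
    proof (rule nn_integral_mono)
      fix y
      have "ennreal \<bar>f y\<bar> \<le> ennreal \<beta> + ennreal (\<bar>f y\<bar> - \<beta>)"
      proof (cases "\<beta> \<le> \<bar>f y\<bar>")
        case True
        then show ?thesis using \<open>0 < \<beta>\<close> by (subst ennreal_plus[symmetric]) auto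
      next
        case False
        then show ?thesis by (intro add_increasing2 ennreal_leI) auto
      qed
      then show "ennreal \<bar>f y\<bar> * ennreal (\<eta> (y - x)) \<le> ennreal \<beta> * ennreal (\<eta> (y - x)) + ennreal (\<bar>f y\<bar> - \<beta>) * ennreal (\<eta> (y - x))"
        unfolding distrib_right[symmetric] by (rule mult_right_mono) simp
    qed
    also have "\<dots> = ennreal \<beta> * (\<integral>\<^sup>+y. ennreal (\<eta> (y - x)) \<partial>lborel) + H x"
      unfolding H_def by (subst nn_integral_add) (auto simp: nn_integral_cmult)
    also have "\<dots> \<le> ennreal \<beta> * 1 + H x"
      by (intro add_mono mult_left_mono mass_shift) auto
    finally show ?thesis by simp
  qed
  have "{x. \<alpha> < \<bar>mollify f x\<bar>} \<subseteq> {x \<in> UNIV. 1 \<le> ennreal (1 / \<beta>) * H x}"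
  proof safe
    fix x assume "\<alpha> < \<bar>mollify f x\<bar>"
    then have "ennreal (\<beta> + \<beta>) \<le> ennreal \<bar>mollify f x\<bar>"
      by (intro ennreal_leI) (simp add: \<beta>_def)
    also note le[of x]
    finally have "ennreal \<beta> + ennreal \<beta> \<le> ennreal \<beta> + H x"
      using \<open>0 < \<beta>\<close> by (simp only: ennreal_plus less_imp_le)
    then have "ennreal \<beta> \<le> H x" by (simp add: ennreal_add_left_cancel_le)
    then have "ennreal (1 / \<beta>) * ennreal \<beta> \<le> ennreal (1 / \<beta>) * H x"
      by (intro mult_left_mono) auto
    then show "1 \<le> ennreal (1 / \<beta>) * H x"
      using \<open>0 < \<beta>\<close> by (simp add: ennreal_mult[symmetric])
  qed auto
  then have "emeasure lborel {x. \<alpha> < \<bar>mollify f x\<bar>} \<le> emeasure lborel {x \<in> UNIV. 1 \<le> ennreal (1 / \<beta>) * H x}"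
    by (rule emeasure_mono) measurable
  also have "\<dots> \<le> ennreal (1 / \<beta>) * (\<integral>\<^sup>+x. H x * indicator UNIV x \<partial>lborel)"
    by (rule nn_integral_Markov_inequality) auto
  also have "(\<integral>\<^sup>+x. H x * indicator UNIV x \<partial>lborel) \<le> (\<integral>\<^sup>+y. ennreal (\<bar>f y\<bar> - \<beta>) \<partial>lborel)"
    unfolding H_def using nn_integral_mollify[of "\<lambda>y. ennreal (\<bar>f y\<bar> - \<beta>)"] by simp
  also have "\<dots> \<le> ennreal (16 * V / \<beta>)"
    using V \<open>0 \<le> V\<close> \<open>0 < \<beta>\<close> by (intro excess_integral_le) auto
  also have "ennreal (1 / \<beta>) * ennreal (16 * V / \<beta>) = ennreal (1 / \<beta> * (16 * V / \<beta>))"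
    using \<open>0 < \<beta>\<close> \<open>0 \<le> V\<close> by (intro ennreal_mult[symmetric]) auto
  also have "1 / \<beta> * (16 * V / \<beta>) = 64 * V / \<alpha>\<^sup>2"
    using \<open>0 < \<alpha>\<close> by (simp add: \<beta>_def field_simps power2_eq_square)
  finally show ?thesis by (simp add: mult_left_mono)
qed

end

section \<open>Derivatives of test functions\<close>

lemma test_function_has_derivative:
  assumes "\<phi> \<in> test_functions \<Omega>"
  shows "(\<phi> has_derivative frechet_derivative \<phi> (at x)) (at x)"
proof -
  have "Ck 1 \<phi>" using assms by (simp add: test_functions_def)
  then show ?thesis by (simp add: frechet_derivative_works[symmetric])
qed

lemma test_function_continuous: "\<phi> \<in> test_functions \<Omega> \<Longrightarrow> continuous_on UNIV \<phi>"
  by (metis test_function_has_derivative has_derivative_continuous continuous_at_imp_continuous_on)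

lemma test_function_partial_continuous:
  assumes "\<phi> \<in> test_functions \<Omega>" "e \<in> Basis"
  shows "continuous_on UNIV (\<lambda>x. frechet_derivative \<phi> (at x) e)"
proof -
  have "Ck (Suc 0) \<phi>" using assms by (auto simp only: test_functions_def mem_Collect_eq)
  then show ?thesis using assms(2) by auto
qed

lemma test_function_partial_eq_0:
  assumes "\<phi> \<in> test_functions \<Omega>" "x \<notin> closure {x. \<phi> x \<noteq> 0}"
  shows "frechet_derivative \<phi> (at x) e = 0"
proof -
  have "(\<phi> has_derivative (\<lambda>_. 0)) (at x)"
    by (rule has_derivative_transform_within_open[of "\<lambda>_. 0" _ _ _ "- closure {x. \<phi> x \<noteq> 0}"])
       (use assms(2) closure_subset[of "{x. \<phi> x \<noteq> 0}"] in auto)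
  then show ?thesis using frechet_derivative_at by metis
qed

lemma test_function_partial_bounded:
  assumes \<phi>: "\<phi> \<in> test_functions \<Omega>" and e: "e \<in> Basis"
  obtains M where "\<And>x. \<bar>frechet_derivative \<phi> (at x) e\<bar> \<le> M"
proof -
  let ?S = "closure {x. \<phi> x \<noteq> 0}"
  have "compact ?S" using \<phi> by (simp add: test_functions_def)
  then have "bounded ((\<lambda>x. frechet_derivative \<phi> (at x) e) ` ?S)"
    by (intro compact_imp_bounded compact_continuous_image
      continuous_on_subset[OF test_function_partial_continuous[OF assms]]) auto
  then obtain M where "0 < M" "\<And>x. x \<in> ?S \<Longrightarrow> norm (frechet_derivative \<phi> (at x) e) \<le> M"
    by (auto simp: bounded_pos)
  then show ?thesis using test_function_partial_eq_0[OF \<phi>]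
    by (intro that[of M]) (metis abs_zero less_imp_le real_norm_def)
qed

lemma test_function_line_derivative:
  assumes "\<phi> \<in> test_functions \<Omega>"
  shows "((\<lambda>t. \<phi> (y + t *\<^sub>R e)) has_real_derivative frechet_derivative \<phi> (at (y + t *\<^sub>R e)) e) (at t)"
proof -
  note d = test_function_has_derivative[OF assms, of "y + t *\<^sub>R e"]
  have "((\<lambda>t. y + t *\<^sub>R e) has_derivative (\<lambda>s. s *\<^sub>R e)) (at t)"
    by (auto intro!: derivative_eq_intros)
  from has_derivative_compose[OF this d]
  show ?thesis
    using linear_cmul[OF has_derivative_linear[OF d]]
    by (simp add: has_field_derivative_def mult.commute[of _ "frechet_derivative \<phi> (at (y + t *\<^sub>R e)) e"])
qed

lemma frechet_derivative_shift:
  assumes "\<phi> \<in> test_functions \<Omega>"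
  shows "frechet_derivative (\<lambda>y. \<phi> (y - x)) (at y) = frechet_derivative \<phi> (at (y - x))"
proof -
  have "((\<lambda>y. y - x) has_derivative (\<lambda>z. z)) (at y)"
    by (auto intro!: derivative_eq_intros)
  from has_derivative_compose[OF this test_function_has_derivative[OF assms, of "y - x"]]
  show ?thesis by (rule frechet_derivative_at[symmetric])
qed

section \<open>The estimate for weakly differentiable functions of the plane\<close>

definition box_kernel :: "real \<Rightarrow> nat \<Rightarrow> 'a::euclidean_space \<Rightarrow> real" where
  "box_kernel h n y = bump (real (Suc n)) h y / h ^ DIM('a)"

lemma box_kernel_test_function:
  "(\<lambda>y. box_kernel h n (y - x)) \<in> test_functions UNIV"
proof -
  note b = bump_test_function[of "real (Suc n)" h x]
  have "Ck k (\<lambda>y. inverse (h ^ DIM('a)) * bump (real (Suc n)) h (y - x))" for k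
    using b by (intro Ck_mult Ck_const) (auto simp: test_functions_def)
  then have "Ck k (\<lambda>y. box_kernel h n (y - x))" for k
    by (simp add: box_kernel_def divide_inverse mult.commute)
  moreover have "{y. box_kernel h n (y - x) \<noteq> 0} \<subseteq> {y. bump (real (Suc n)) h (y - x) \<noteq> 0}"
    by (auto simp: box_kernel_def)
  moreover have "bounded {y. bump (real (Suc n)) h (y - x) \<noteq> 0}"
    using b by (auto simp: test_functions_def)
  ultimately show ?thesis
    by (auto simp: test_functions_def dest: bounded_subset)
qed

lemma box_kernel_mollifier:
  assumes "0 < h"
  shows "mollifier (box_kernel h n :: 'a::euclidean_space \<Rightarrow> real) (cbox 0 (h *\<^sub>R One))"
proof
  have le: "box_kernel h n y \<le> indicator (cbox 0 (h *\<^sub>R One)) y / h ^ DIM('a)" for y :: 'a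
  proof (cases "y \<in> cbox 0 (h *\<^sub>R One)")
    case True
    then show ?thesis using assms bump_le_1[of "real (Suc n)" h y]
      by (simp add: box_kernel_def divide_right_mono)
  next
    case False
    then have "y \<notin> box 0 (h *\<^sub>R One)" using box_subset_cbox by blast
    with False show ?thesis by (simp add: box_kernel_def bump_eq_0)
  qed
  show "continuous_on UNIV (box_kernel h n :: 'a \<Rightarrow> real)"
    using test_function_continuous[OF box_kernel_test_function[of h n 0]] by simp
  show "0 \<le> box_kernel h n x" for x :: 'a using assms by (simp add: box_kernel_def bump_nonneg)
  show "box_kernel h n x = 0" if "x \<notin> cbox 0 (h *\<^sub>R One)" for x :: 'a
    using that bump_eq_0[of "real (Suc n)" x h] box_subset_cbox[of 0 "h *\<^sub>R One::'a"] 
    by (auto simp: box_kernel_def)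
  have "(\<integral>\<^sup>+(y::'a). ennreal (box_kernel h n y) \<partial>lborel)
    \<le> (\<integral>\<^sup>+(y::'a). ennreal (1 / h ^ DIM('a)) * indicator (cbox 0 (h *\<^sub>R One)) y \<partial>lborel)"
    using le by (intro nn_integral_mono) 
      (smt (verit) divide_eq_0_iff ennreal_leI indicator_simps mult.right_neutral mult_zero_right ennreal_0)
  also have "\<dots> = ennreal (1 / h ^ DIM('a)) * ennreal (h ^ DIM('a))"
    using assms by (subst nn_integral_cmult) (auto simp: emeasure_lborel_cbox_eq)
  also have "\<dots> = 1" using assms by (simp add: ennreal_mult[symmetric])
  finally show "(\<integral>\<^sup>+(y::'a). ennreal (box_kernel h n y) \<partial>lborel) \<le> 1" .
qed simp

text \<open>
  This is why the kernel approximates a box: the limit of the mollifications is the average for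
  which \<open>integrable_ccontinuous_explicit\<close> provides convergence almost everywhere.
\<close>
lemma mollify_tendsto_box_average:
  fixes f :: "'a::euclidean_space \<Rightarrow> real"
  assumes f: "loc_integrable f" and "0 < h"
  shows "(\<lambda>n. mollifier.mollify (box_kernel h n) f x) \<longlonglongrightarrow> integral (cbox x (x + h *\<^sub>R One)) f /\<^sub>R h ^ DIM('a)"
proof -
  have [measurable]: "f \<in> borel_measurable borel" using f by (simp add: loc_integrable_def)
  have si: "set_integrable lborel (cbox x (x + h *\<^sub>R One)) f" using f by (simp add: loc_integrable_def)
  have sib: "set_integrable lborel (box x (x + h *\<^sub>R One)) f"
    using si by (rule set_integrable_subset) (auto simp: box_subset_cbox)
  have mem: "y - x \<in> box 0 (h *\<^sub>R One) \<longleftrightarrow> y \<in> box x (x + h *\<^sub>R One)" for y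
    by (auto simp: mem_box inner_diff_left inner_add_left)
  have "(\<lambda>n. \<integral>y. f y * box_kernel h n (y - x) \<partial>lborel)
    \<longlonglongrightarrow> (\<integral>y. f y * (indicator (box 0 (h *\<^sub>R One)) (y - x) / h ^ DIM('a)) \<partial>lborel)"
  proof (rule integral_dominated_convergence)
    show "integrable lborel (\<lambda>y. norm (indicator (box x (x + h *\<^sub>R One)) y *\<^sub>R f y) / h ^ DIM('a))"
      using sib by (intro integrable_divide integrable_norm) (auto simp: set_integrable_def)
    show "AE y in lborel. (\<lambda>n. f y * box_kernel h n (y - x)) \<longlonglongrightarrow> f y * (indicator (box 0 (h *\<^sub>R One)) (y - x) / h ^ DIM('a))"
      unfolding box_kernel_def using \<open>0 < h\<close>
      by (intro AE_I2 tendsto_intros bump_tendsto) auto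
    show "AE y in lborel. norm (f y * box_kernel h n (y - x)) \<le> norm (indicator (box x (x + h *\<^sub>R One)) y *\<^sub>R f y) / h ^ DIM('a)" for n
    proof (intro AE_I2)
      fix y
      show "norm (f y * box_kernel h n (y - x)) \<le> norm (indicator (box x (x + h *\<^sub>R One)) y *\<^sub>R f y) / h ^ DIM('a)"
      proof (cases "y - x \<in> box 0 (h *\<^sub>R One)")
        case True
        have "\<bar>f y\<bar> * bump (real (Suc n)) h (y - x) \<le> \<bar>f y\<bar> * 1"
          by (intro mult_left_mono bump_le_1) auto
        then show ?thesis
          using True \<open>0 < h\<close> unfolding mem
          by (simp add: box_kernel_def abs_mult bump_nonneg divide_right_mono)
      next
        case False
        then show ?thesis using \<open>0 < h\<close> by (simp add: box_kernel_def bump_eq_0)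
      qed
    qed
    have "box_kernel h n \<in> borel_measurable borel" for n
      by (rule mollifier.measurable_kernel[OF box_kernel_mollifier[OF \<open>0 < h\<close>]])
    note [measurable] = this
    show "(\<lambda>y. f y * box_kernel h n (y - x)) \<in> borel_measurable lborel" for n by measurable
  qed measurable
  also have "(\<integral>y. f y * (indicator (box 0 (h *\<^sub>R One)) (y - x) / h ^ DIM('a)) \<partial>lborel)
    = (\<integral>y. (indicator (box x (x + h *\<^sub>R One)) y *\<^sub>R f y) / h ^ DIM('a) \<partial>lborel)"
    by (intro Bochner_Integration.integral_cong) (auto simp: indicator_def mem)
  also have "\<dots> = (LINT y:box x (x + h *\<^sub>R One)|lborel. f y) / h ^ DIM('a)"
    by (simp add: set_lebesgue_integral_def)
  also have "\<dots> = integral (cbox x (x + h *\<^sub>R One)) f /\<^sub>R h ^ DIM('a)"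
    by (simp add: set_borel_integral_eq_integral(2)[OF sib] integral_open_interval divide_inverse mult.commute)
  finally show ?thesis
    by (simp add: mollifier.mollify_def[OF box_kernel_mollifier[OF \<open>0 < h\<close>]])
qed

lemma line_derivative_plane:
  fixes F G :: "real^2 \<Rightarrow> real"
  shows "(\<And>p. ((\<lambda>t. F (p + t *\<^sub>R axis 1 1)) has_real_derivative G p) (at 0)) \<Longrightarrow>
      ((\<lambda>s. F (vector [s, y])) has_real_derivative G (vector [x, y])) (at x)"
    and "(\<And>p. ((\<lambda>t. F (p + t *\<^sub>R axis 2 1)) has_real_derivative G p) (at 0)) \<Longrightarrow>
      ((\<lambda>s. F (vector [x, s])) has_real_derivative G (vector [x, y])) (at y)"
proof -
  have e1: "vector [s, y] = (vector [x, y] :: real^2) + (s - x) *\<^sub>R axis 1 1" for s x y :: real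
    by (simp add: vec_eq_iff forall_2 axis_def)
  have e2: "vector [x, s] = (vector [x, y] :: real^2) + (s - y) *\<^sub>R axis 2 1" for s x y :: real
    by (simp add: vec_eq_iff forall_2 axis_def)
  have d: "((\<lambda>s. s - a) has_real_derivative 1) (at a)" for a :: real
    by (auto intro!: derivative_eq_intros)
  show "((\<lambda>s. F (vector [s, y])) has_real_derivative G (vector [x, y])) (at x)"
    if "\<And>p. ((\<lambda>t. F (p + t *\<^sub>R axis 1 1)) has_real_derivative G p) (at 0)"
    using DERIV_chain2[of "\<lambda>t. F (vector [x, y] + t *\<^sub>R axis 1 1)" _ "\<lambda>s. s - x" x, OF _ d] that
    by (subst e1[of _ y x]) simp
  show "((\<lambda>s. F (vector [x, s])) has_real_derivative G (vector [x, y])) (at y)"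
    if "\<And>p. ((\<lambda>t. F (p + t *\<^sub>R axis 2 1)) has_real_derivative G p) (at 0)"
    using DERIV_chain2[of "\<lambda>t. F (vector [x, y] + t *\<^sub>R axis 2 1)" _ "\<lambda>s. s - y" y, OF _ d] that
    by (subst e2[of x _ y]) simp
qed

text \<open>
  The estimate for differentiable functions holds uniformly for all mollifications of \<open>f\<close>. Fatou's
  lemma carries it first to the averages over boxes of side \<open>h\<close>, then, as \<open>h \<rightarrow> 0\<close>, to \<open>f\<close>.
\<close>
lemma L4_bound_weakly_differentiable:
  fixes f g1 g2 :: "real^2 \<Rightarrow> real"
  assumes f: "loc_integrable f" and g1: "loc_integrable g1" and g2: "loc_integrable g2"
    and parts1: "\<And>\<phi>. \<phi> \<in> test_functions UNIV \<Longrightarrow>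
      (\<integral>y. f y * frechet_derivative \<phi> (at y) (axis 1 1) \<partial>lborel) = - (\<integral>y. g1 y * \<phi> y \<partial>lborel)"
    and parts2: "\<And>\<phi>. \<phi> \<in> test_functions UNIV \<Longrightarrow>
      (\<integral>y. f y * frechet_derivative \<phi> (at y) (axis 2 1) \<partial>lborel) = - (\<integral>y. g2 y * \<phi> y \<partial>lborel)"
    and V: "\<And>l. 0 < l \<Longrightarrow> emeasure lborel {p. l < \<bar>f p\<bar>} \<le> ennreal (V / l\<^sup>2)" and "0 \<le> V"
  shows "(\<integral>\<^sup>+p. ennreal (f p ^ 4) \<partial>lborel)
    \<le> ennreal (256 * (64 * V)) * (\<integral>\<^sup>+p. ennreal ((g1 p)\<^sup>2 + (g2 p)\<^sup>2) \<partial>lborel)" (is "_ \<le> ?K")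
proof -
  have meas[measurable]: "f \<in> borel_measurable borel" "g1 \<in> borel_measurable borel" "g2 \<in> borel_measurable borel"
    using f g1 g2 by (auto simp: loc_integrable_def)
  define A where "A h x = integral (cbox x (x + h *\<^sub>R One)) f /\<^sub>R h ^ DIM(real^2)" for h and x :: "real^2"
  define F where "F h n = mollifier.mollify (box_kernel h n) f" for h n
  have Fcont: "continuous_on UNIV (F h n)" if "0 < h" for h n
    unfolding F_def by (rule mollifier.continuous_mollify[OF box_kernel_mollifier[OF that] f])
  have Fmeas: "F h n \<in> borel_measurable borel" if "0 < h" for h n
    by (rule borel_measurable_continuous_onI[OF Fcont[OF that]])
  have FA: "(\<lambda>n. F h n x) \<longlonglongrightarrow> A h x" if "0 < h" for h x
    unfolding F_def A_def by (rule mollify_tendsto_box_average[OF f that])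
  have Ameas: "A h \<in> borel_measurable borel" if "0 < h" for h
    by (rule borel_measurable_LIMSEQ_real[OF FA[OF that] Fmeas[OF that]])
  have F4: "(\<integral>\<^sup>+p. ennreal (F h n p ^ 4) \<partial>lborel) \<le> ?K" if "0 < h" for h n
  proof -
    interpret mollifier "box_kernel h n :: real^2 \<Rightarrow> real" "cbox 0 (h *\<^sub>R One)"
      by (rule box_kernel_mollifier[OF \<open>0 < h\<close>])
    define G1 where "G1 = mollify g1"
    define G2 where "G2 = mollify g2"
    have k: "box_kernel h n \<in> test_functions (UNIV :: (real^2) set)"
      using box_kernel_test_function[of h n 0] by simp
    have B: "axis 1 1 \<in> (Basis :: (real^2) set)" "axis 2 1 \<in> (Basis :: (real^2) set)"
      by (auto simp: axis_in_Basis_iff)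
    obtain M1 where M1: "\<And>x. \<bar>frechet_derivative (box_kernel h n) (at x) (axis 1 1 :: real^2)\<bar> \<le> M1"
      by (rule test_function_partial_bounded[OF k B(1)]) blast
    obtain M2 where M2: "\<And>x. \<bar>frechet_derivative (box_kernel h n) (at x) (axis 2 1 :: real^2)\<bar> \<le> M2"
      by (rule test_function_partial_bounded[OF k B(2)]) blast
    have d1: "((\<lambda>t. F h n (p + t *\<^sub>R axis 1 1)) has_real_derivative G1 p) (at 0)" for p
      unfolding F_def G1_def
      by (rule mollify_has_derivative[OF f test_function_line_derivative[OF k] M1])
         (use parts1[OF box_kernel_test_function[of h n p]] in \<open>simp add: frechet_derivative_shift[OF k]\<close>)
    have d2: "((\<lambda>t. F h n (p + t *\<^sub>R axis 2 1)) has_real_derivative G2 p) (at 0)" for p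
      unfolding F_def G2_def
      by (rule mollify_has_derivative[OF f test_function_line_derivative[OF k] M2])
         (use parts2[OF box_kernel_test_function[of h n p]] in \<open>simp add: frechet_derivative_shift[OF k]\<close>)
    have c: "continuous_on UNIV G1" "continuous_on UNIV G2"
      unfolding G1_def G2_def by (intro continuous_mollify g1 g2)+
    have [measurable]: "G1 \<in> borel_measurable borel" "G2 \<in> borel_measurable borel"
      using c by (auto intro: borel_measurable_continuous_onI)
    have W: "emeasure lborel {p. l < \<bar>F h n p\<bar>} \<le> ennreal (64 * V / l\<^sup>2)" if "0 < l" for l
      unfolding F_def by (rule mollify_weak_bound[OF f V \<open>0 \<le> V\<close> that])
    have "(\<integral>\<^sup>+p. ennreal (F h n p ^ 4) \<partial>lborel)
      \<le> ennreal (256 * (64 * V)) * (\<integral>\<^sup>+p. ennreal ((G1 p)\<^sup>2 + (G2 p)\<^sup>2) \<partial>lborel)"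
      by (rule L4_bound_C1[OF Fmeas[OF \<open>0 < h\<close>] c line_derivative_plane(1)[OF d1] line_derivative_plane(2)[OF d2] W])
         (use \<open>0 \<le> V\<close> in auto)
    also have "(\<integral>\<^sup>+p. ennreal ((G1 p)\<^sup>2 + (G2 p)\<^sup>2) \<partial>lborel) 
       = (\<integral>\<^sup>+p. ennreal ((G1 p)\<^sup>2) \<partial>lborel) + (\<integral>\<^sup>+p. ennreal ((G2 p)\<^sup>2) \<partial>lborel)"
      by (simp add: nn_integral_add)
    also have "\<dots> \<le> (\<integral>\<^sup>+p. ennreal ((g1 p)\<^sup>2) \<partial>lborel) + (\<integral>\<^sup>+p. ennreal ((g2 p)\<^sup>2) \<partial>lborel)"
      unfolding G1_def G2_def by (intro add_mono mollify_energy g1 g2)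
    also have "\<dots> = (\<integral>\<^sup>+p. ennreal ((g1 p)\<^sup>2 + (g2 p)\<^sup>2) \<partial>lborel)"
      by (simp add: nn_integral_add)
    finally show ?thesis by (simp add: mult_left_mono)
  qed
  have A4: "(\<integral>\<^sup>+p. ennreal (A h p ^ 4) \<partial>lborel) \<le> ?K" if "0 < h" for h
  proof (rule nn_integral_le_of_AE_tendsto[OF _ _ F4[OF that] tendsto_const])
    show "(\<lambda>p. ennreal (F h n p ^ 4)) \<in> borel_measurable lborel" for n
      using Fmeas[OF that, of n] by measurable
    show "AE p in lborel. (\<lambda>n. ennreal (F h n p ^ 4)) \<longlonglongrightarrow> ennreal (A h p ^ 4)"
      using FA[OF that] by (intro AE_I2 tendsto_ennrealI tendsto_power)
  qed
  define h where "h k = inverse (real (Suc k))" for k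
  have h: "0 < h k" for k by (simp add: h_def)
  have "f integrable_on cbox a b" for a b
    using f by (auto simp: loc_integrable_def intro: set_borel_integral_eq_integral(1))
  then obtain N where N: "negligible N" and
    Nlim: "\<And>x e. \<lbrakk>x \<notin> N; 0 < e\<rbrakk> \<Longrightarrow> \<exists>d>0. \<forall>h. 0 < h \<and> h < d \<longrightarrow>
         norm (integral (cbox x (x + h *\<^sub>R One)) f /\<^sub>R h ^ DIM(real^2) - f x) < e"
    by (rule integrable_ccontinuous_explicit) blast
  have lim: "(\<lambda>k. A (h k) x) \<longlonglongrightarrow> f x" if "x \<notin> N" for x
  proof (rule tendstoI)
    fix e :: real assume "0 < e"
    then obtain d where d: "0 < d" "\<And>h. 0 < h \<Longrightarrow> h < d \<Longrightarrow> norm (A h x - f x) < e"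
      using Nlim[OF \<open>x \<notin> N\<close> \<open>0 < e\<close>] unfolding A_def by metis
    have "\<forall>\<^sub>F k in sequentially. h k < d"
      unfolding h_def using LIMSEQ_inverse_real_of_nat \<open>0 < d\<close> by (rule order_tendstoD)
    then show "\<forall>\<^sub>F k in sequentially. dist (A (h k) x) (f x) < e"
      by eventually_elim (use d(2)[OF h] in \<open>auto simp: dist_norm\<close>)
  qed
  have AE: "AE x in lborel. x \<notin> N"
  proof -
    have "AE x in lebesgue. x \<notin> N"
      using N by (auto simp: negligible_iff_null_sets intro: AE_not_in)
    then show ?thesis by (simp add: AE_completion_iff)
  qed
  show ?thesis
  proof (rule nn_integral_le_of_AE_tendsto[OF _ _ A4[OF h] tendsto_const])
    show "(\<lambda>p. ennreal (A (h k) p ^ 4)) \<in> borel_measurable lborel" for k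
      using Ameas[OF h, of k] by measurable
    show "AE p in lborel. (\<lambda>k. ennreal (A (h k) p ^ 4)) \<longlonglongrightarrow> ennreal (f p ^ 4)"
      using AE by eventually_elim (intro tendsto_ennrealI tendsto_power lim)
  qed
qed

section \<open>Norms and integrals\<close>

lemma powr_2_norm: "norm x powr 2 = (norm x)\<^sup>2"
  by (cases "norm x = 0") auto

lemma powr_4_abs: "\<bar>t\<bar> powr 4 = (t::real) ^ 4"
  by (cases "t = 0") auto

text \<open>
  The inequality that defines the competitors \<open>C\<close> in the weak norm is closed in \<open>C\<close>, so it holds for
  their infimum too. Taking \<open>C\<close> above the infimum first also covers the infimum 0, which is not
  itself a competitor.
\<close>
lemma weak_L2_norm_bound:
  fixes f :: "'a::euclidean_space \<Rightarrow> real"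
  assumes fin: "weak_Lp_norm 2 \<Omega> f < \<infinity>" and "0 < \<alpha>"
  shows "emeasure lebesgue {x \<in> \<Omega>. \<alpha> < \<bar>f x\<bar>} \<le> ennreal ((enn2real (weak_Lp_norm 2 \<Omega> f))\<^sup>2 / \<alpha>\<^sup>2)"
proof -
  define W where "W = enn2real (weak_Lp_norm 2 \<Omega> f)"
  have W: "weak_Lp_norm 2 \<Omega> f = ennreal W" "0 \<le> W" using fin by (auto simp: W_def)
  have "emeasure lebesgue {x \<in> \<Omega>. \<alpha> < \<bar>f x\<bar>} \<le> ennreal (C\<^sup>2 / \<alpha>\<^sup>2)" if "W < C" for C
  proof -
    have "weak_Lp_norm 2 \<Omega> f < ennreal C" using W that by (simp add: ennreal_less_iff)
    then obtain D where D: "D > 0" "ennreal D < ennreal C"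
        "\<And>\<alpha>. 0 < \<alpha> \<Longrightarrow> distribution_fun \<Omega> f \<alpha> \<le> ennreal (D powr 2 / \<alpha> powr 2)"
      unfolding weak_Lp_norm_def Inf_less_iff by auto
    have "D < C" using D by (simp add: ennreal_less_iff)
    have "emeasure lebesgue {x \<in> \<Omega>. \<alpha> < \<bar>f x\<bar>} \<le> ennreal (D\<^sup>2 / \<alpha>\<^sup>2)"
      using D(3)[OF \<open>0 < \<alpha>\<close>] \<open>D > 0\<close> \<open>0 < \<alpha>\<close> by (simp add: distribution_fun_def)
    also have "\<dots> \<le> ennreal (C\<^sup>2 / \<alpha>\<^sup>2)"
      using \<open>D > 0\<close> \<open>D < C\<close> by (intro ennreal_leI divide_right_mono power_mono) auto
    finally show ?thesis .
  qed
  then have "\<forall>\<^sub>F C in at_right W. emeasure lebesgue {x \<in> \<Omega>. \<alpha> < \<bar>f x\<bar>} \<le> ennreal (C\<^sup>2 / \<alpha>\<^sup>2)"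
    by (auto simp: eventually_at_filter intro!: always_eventually)
  moreover have "((\<lambda>C. ennreal (C\<^sup>2 / \<alpha>\<^sup>2)) \<longlongrightarrow> ennreal (W\<^sup>2 / \<alpha>\<^sup>2)) (at_right W)"
    using \<open>0 < \<alpha>\<close> by (intro tendsto_ennrealI tendsto_intros) auto
  ultimately show ?thesis
    unfolding W_def[symmetric] by (intro tendsto_lowerbound) auto
qed

text \<open>
  The constant is \<open>20736 = 12^4\<close>, a convenient fourth power above the constants 16384 and 2048
  which the proofs for the plane and for \<open>H10 \<Omega>\<close> produce.
\<close>
lemma norm_inequality_from_integrals:
  assumes I: "I \<le> ennreal (20736 * W\<^sup>2) * \<Gamma>" and "0 \<le> W" and "\<Gamma> < \<infinity>"
  shows "enn_powr I (1/4) \<le> ennreal 12 * enn_powr (ennreal W) (1/2) * enn_powr (enn_powr \<Gamma> (1/2)) (1/2)"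
proof -
  obtain \<gamma> where \<gamma>: "\<Gamma> = ennreal \<gamma>" "0 \<le> \<gamma>" using \<open>\<Gamma> < \<infinity>\<close> by (cases \<Gamma>) auto
  have I': "I \<le> ennreal (20736 * W\<^sup>2 * \<gamma>)"
    using I \<gamma> \<open>0 \<le> W\<close> by (simp add: ennreal_mult)
  then have "I < \<infinity>" by (simp add: le_less_trans)
  then obtain i where i: "I = ennreal i" "0 \<le> i" by (cases I) auto
  have "i \<le> 20736 * W\<^sup>2 * \<gamma>"
    using I' \<gamma> i by (subst (asm) i) (simp add: ennreal_le_iff)
  then have "i powr (1/4) \<le> (20736 * W\<^sup>2 * \<gamma>) powr (1/4)"
    using i by (intro powr_mono2) auto
  also have "\<dots> = 20736 powr (1/4) * (W\<^sup>2) powr (1/4) * \<gamma> powr (1/4)"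
    using \<gamma> by (simp add: powr_mult)
  also have "20736 powr (1/4) = (12::real)"
  proof -
    have "(20736::real) = 12 powr 4" by simp
    then show ?thesis by (simp only: powr_powr) simp
  qed
  also have "(W\<^sup>2) powr (1/4) = W powr (1/2)"
  proof -
    have "W\<^sup>2 = W powr 2" using \<open>0 \<le> W\<close> by (cases "W = 0") auto
    then show ?thesis by (simp add: powr_powr)
  qed
  also have "\<gamma> powr (1/4) = (\<gamma> powr (1/2)) powr (1/2)"
    by (simp add: powr_powr)
  finally have "i powr (1/4) \<le> 12 * W powr (1/2) * (\<gamma> powr (1/2)) powr (1/2)" .
  then have "ennreal (i powr (1/4)) \<le> ennreal (12 * W powr (1/2) * (\<gamma> powr (1/2)) powr (1/2))"
    by (rule ennreal_leI)
  then show ?thesis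
    using \<open>0 \<le> W\<close> \<gamma> i by (simp add: enn_powr_def ennreal_mult)
qed

lemma Lp_norm_2: "Lp_norm 2 \<Omega> g = enn_powr (\<integral>\<^sup>+x. ennreal ((norm (g x))\<^sup>2) \<partial>lebesgue_on \<Omega>) (1/2)"
  by (simp add: Lp_norm_def powr_2_norm)

lemma Lp_norm_4: "Lp_norm 4 \<Omega> (f :: _ \<Rightarrow> real) = enn_powr (\<integral>\<^sup>+x. ennreal (f x ^ 4) \<partial>lebesgue_on \<Omega>) (1/4)"
  by (simp add: Lp_norm_def powr_4_abs)

lemma Lp_norm_2_finite_iff:
  "Lp_norm 2 \<Omega> g < \<infinity> \<longleftrightarrow> (\<integral>\<^sup>+x. ennreal ((norm (g x))\<^sup>2) \<partial>lebesgue_on \<Omega>) < \<infinity>"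
  unfolding Lp_norm_2 by (auto simp: enn_powr_def top.not_eq_extremum)

lemma gradient_inner_Basis: "e \<in> Basis \<Longrightarrow> gradient \<phi> x \<bullet> e = frechet_derivative \<phi> (at x) e"
  unfolding gradient_def inner_sum_left by (simp add: inner_Basis if_distrib cong: if_cong)

lemma integrable_scaled_by_compact_support:
  fixes u :: "'a::euclidean_space \<Rightarrow> 'b::euclidean_space" and b :: "'a \<Rightarrow> real"
  assumes u: "locally_integrable UNIV u" and b: "continuous_on UNIV b" "compact K" "\<And>x. x \<notin> K \<Longrightarrow> b x = 0"
  shows "integrable lebesgue (\<lambda>x. b x *\<^sub>R u x)"
proof -
  have "bounded (b ` K)"
    by (intro compact_imp_bounded compact_continuous_image continuous_on_subset[OF b(1)] b) auto
  then obtain M where M: "0 < M" "\<And>x. x \<in> K \<Longrightarrow> \<bar>b x\<bar> \<le> M"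
    by (auto simp: bounded_pos)
  have K: "K \<in> sets lebesgue" using \<open>compact K\<close> by (auto dest: compact_imp_closed)
  have "integrable (lebesgue_on K) u" using u \<open>compact K\<close> by (simp add: locally_integrable_def)
  then have iK: "integrable lebesgue (\<lambda>x. indicator K x *\<^sub>R u x)"
    using K by (simp add: integrable_restrict_space)
  have [measurable]: "b \<in> borel_measurable lebesgue"
    using borel_measurable_continuous_onI[OF b(1)] by (simp add: measurable_completion)
  have eq: "b x *\<^sub>R u x = b x *\<^sub>R (indicator K x *\<^sub>R u x)" for x
    using b(3) by (auto simp: indicator_def)
  show ?thesis
  proof (rule Bochner_Integration.integrable_bound)
    show "integrable lebesgue (\<lambda>x. M * norm (indicator K x *\<^sub>R u x))"
      using iK by (intro integrable_mult_right integrable_norm)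
    show "(\<lambda>x. b x *\<^sub>R u x) \<in> borel_measurable lebesgue"
      unfolding eq using borel_measurable_integrable[OF iK] by measurable
    show "AE x in lebesgue. norm (b x *\<^sub>R u x) \<le> norm (M * norm (indicator K x *\<^sub>R u x))"
      using M b(3) by (intro AE_I2) (auto simp: indicator_def abs_mult intro!: mult_right_mono)
  qed
qed

section \<open>The inequality on the plane\<close>

text \<open>
  The vector identity can be read in coordinates only once both integrands are known to be
  integrable, since the Bochner integral of a non-integrable function is 0.
\<close>
lemma weak_gradient_component:
  fixes f :: "'a::euclidean_space \<Rightarrow> real"
  assumes wg: "has_weak_gradient UNIV f g" and \<phi>: "\<phi> \<in> test_functions UNIV" and e: "e \<in> Basis"
  shows "(\<integral>x. f x * frechet_derivative \<phi> (at x) e \<partial>lebesgue) = - (\<integral>x. (g x \<bullet> e) * \<phi> x \<partial>lebesgue)"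
proof -
  let ?K = "closure {x. \<phi> x \<noteq> 0}"
  have K: "compact ?K" using \<phi> by (simp add: test_functions_def)
  have loc: "locally_integrable UNIV f" "locally_integrable UNIV g"
    using wg by (auto simp: has_weak_gradient_def)
  have i1: "integrable lebesgue (\<lambda>x. \<phi> x *\<^sub>R g x)"
    by (rule integrable_scaled_by_compact_support[OF loc(2) test_function_continuous[OF \<phi>] K])
       (use closure_subset[of "{x. \<phi> x \<noteq> 0}"] in auto)
  have "integrable lebesgue (\<lambda>x. frechet_derivative \<phi> (at x) i *\<^sub>R f x)" if "i \<in> Basis" for i
    by (rule integrable_scaled_by_compact_support[OF loc(1) test_function_partial_continuous[OF \<phi> that] K])
       (use test_function_partial_eq_0[OF \<phi>] in auto)
  then have "integrable lebesgue (\<lambda>x. \<Sum>i\<in>Basis. (frechet_derivative \<phi> (at x) i *\<^sub>R f x) *\<^sub>R i)"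
    by (intro Bochner_Integration.integrable_sum integrable_scaleR_left) auto
  then have i2: "integrable lebesgue (\<lambda>x. f x *\<^sub>R gradient \<phi> x)"
    by (simp add: gradient_def scaleR_sum_right mult.commute)
  have "(\<integral>x. f x *\<^sub>R gradient \<phi> x \<partial>lebesgue) = - (\<integral>x. \<phi> x *\<^sub>R g x \<partial>lebesgue)"
    using wg \<phi> by (auto simp: has_weak_gradient_def lebesgue_on_UNIV_eq)
  then have "(\<integral>x. f x *\<^sub>R gradient \<phi> x \<partial>lebesgue) \<bullet> e = - ((\<integral>x. \<phi> x *\<^sub>R g x \<partial>lebesgue) \<bullet> e)"
    by simp
  then have "(\<integral>x. (f x *\<^sub>R gradient \<phi> x) \<bullet> e \<partial>lebesgue) = - (\<integral>x. (\<phi> x *\<^sub>R g x) \<bullet> e \<partial>lebesgue)"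
    by (simp only: integral_inner_left[OF i1] integral_inner_left[OF i2])
  then show ?thesis using e by (simp add: gradient_inner_Basis mult.commute)
qed

lemma lebesgue_integral_borel_version:
  fixes u u' :: "'a::euclidean_space \<Rightarrow> real"
  assumes u: "u \<in> borel_measurable lebesgue" and u': "u' \<in> borel_measurable borel"
    and eq: "AE x in lborel. u x = u' x" and v: "v \<in> borel_measurable borel"
  shows "(\<integral>x. u x * v x \<partial>lebesgue) = (\<integral>x. u' x * v x \<partial>lborel)"
proof -
  note [measurable] = u u' v
  have [measurable]: "v \<in> borel_measurable lebesgue" "u' \<in> borel_measurable lebesgue"
    using u' v by (simp_all add: measurable_completion)
  have "(\<integral>x. u x * v x \<partial>lebesgue) = (\<integral>x. u' x * v x \<partial>lebesgue)"
    by (rule integral_cong_AE, measurable) (rule AE_completion, use eq in eventually_elim, simp)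
  also have "\<dots> = (\<integral>x. u' x * v x \<partial>lborel)"
    by (rule integral_completion) measurable
  finally show ?thesis .
qed

lemma loc_integrable_borel_version:
  fixes u u' :: "'a::euclidean_space \<Rightarrow> real"
  assumes loc: "locally_integrable UNIV u" and u: "u \<in> borel_measurable lebesgue" 
    and u': "u' \<in> borel_measurable borel"
    and eq: "AE x in lborel. u x = u' x"
  shows "loc_integrable u'"
proof -
  have "set_integrable lborel (cbox a b) u'" for a b
  proof -
    have "integrable (lebesgue_on (cbox a b)) u" using loc by (simp add: locally_integrable_def)
    then have i: "integrable lebesgue (\<lambda>x. indicator (cbox a b) x *\<^sub>R u x)"
      by (simp add: integrable_restrict_space)
    have "integrable lebesgue (\<lambda>x. indicator (cbox a b) x *\<^sub>R u' x)"
    proof (rule integrable_cong_AE_imp[OF i])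
      show "AE x in lebesgue. indicator (cbox a b) x *\<^sub>R u x = indicator (cbox a b) x *\<^sub>R u' x"
        by (rule AE_completion, use eq in eventually_elim, simp)
      have "(\<lambda>x. indicator (cbox a b) x *\<^sub>R u' x) \<in> borel_measurable borel"
        using u' by measurable
      then show "(\<lambda>x. indicator (cbox a b) x *\<^sub>R u' x) \<in> borel_measurable lebesgue"
        by (simp add: measurable_completion)
    qed
    then show ?thesis
      using integrable_completion[of "\<lambda>x. indicator (cbox a b) x *\<^sub>R u' x" lborel] u'
      by (simp add: set_integrable_def)
  qed
  with u' show ?thesis by (simp add: loc_integrable_def)
qed

lemma emeasure_borel_version:
  fixes u u' :: "'a::euclidean_space \<Rightarrow> real"
  assumes u: "u \<in> borel_measurable lebesgue" and u': "u' \<in> borel_measurable borel"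
    and eq: "AE x in lborel. u x = u' x"
  shows "emeasure lborel {x. l < \<bar>u' x\<bar>} = emeasure lebesgue {x. l < \<bar>u x\<bar>}"
proof -
  have u'': "u' \<in> borel_measurable lebesgue" using u' by (simp add: measurable_completion)
  have "{x. l < \<bar>u' x\<bar>} \<in> sets borel" using u' by measurable
  then have "emeasure lborel {x. l < \<bar>u' x\<bar>} = emeasure lebesgue {x. l < \<bar>u' x\<bar>}" by simp
  also have "\<dots> = emeasure lebesgue {x. l < \<bar>u x\<bar>}"
  proof (rule emeasure_eq_AE)
    show "AE x in lebesgue. (x \<in> {x. l < \<bar>u' x\<bar>}) = (x \<in> {x. l < \<bar>u x\<bar>})"
      by (rule AE_completion, use eq in eventually_elim, simp)
    have "{x \<in> space lebesgue. l < \<bar>u' x\<bar>} \<in> sets lebesgue" "{x \<in> space lebesgue. l < \<bar>u x\<bar>} \<in> sets lebesgue"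
      using u u'' by measurable
    then show "{x. l < \<bar>u' x\<bar>} \<in> sets lebesgue" "{x. l < \<bar>u x\<bar>} \<in> sets lebesgue" by simp_all
  qed
  finally show ?thesis .
qed

lemma norm_real_2: "(norm (x :: real^2))\<^sup>2 = (x \<bullet> axis 1 1)\<^sup>2 + (x \<bullet> axis 2 1)\<^sup>2"
  by (simp add: norm_vec_def L2_set_def sum_2 inner_axis)

lemma norm_inequality_plane:
  fixes f :: "real^2 \<Rightarrow> real"
  assumes f: "f \<in> weak_Lp 2 UNIV \<inter> homogeneous_H1 UNIV"
  shows "Lp_norm 4 UNIV f \<le> ennreal 12 * enn_powr (weak_Lp_norm 2 UNIV f) (1/2)
      * enn_powr (Lp_norm 2 UNIV (weak_gradient UNIV f)) (1/2)"
proof -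
  define g where "g = weak_gradient UNIV f"
  define W where "W = enn2real (weak_Lp_norm 2 UNIV f)"
  have fin: "weak_Lp_norm 2 UNIV f < \<infinity>" and fm[measurable]: "f \<in> borel_measurable lebesgue"
    using f by (auto simp: weak_Lp_def lebesgue_on_UNIV_eq)
  have W: "weak_Lp_norm 2 UNIV f = ennreal W" using fin by (simp add: W_def)
  have wg: "has_weak_gradient UNIV f g"
    using f someI_ex[of "has_weak_gradient UNIV f"] by (auto simp: homogeneous_H1_def g_def weak_gradient_def)
  have gm[measurable]: "g \<in> borel_measurable lebesgue" and gfin: "Lp_norm 2 UNIV g < \<infinity>"
    using f by (auto simp: homogeneous_H1_def Lp_def g_def lebesgue_on_UNIV_eq)
  have loc: "locally_integrable UNIV f" "locally_integrable UNIV g"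
    using wg by (auto simp: has_weak_gradient_def)
  have loc_comp: "locally_integrable UNIV (\<lambda>x. g x \<bullet> e)" for e
    using loc(2) by (auto simp: locally_integrable_def)
  obtain f' where f': "f' \<in> borel_measurable borel" "AE x in lborel. f x = f' x"
    using completion_ex_borel_measurable_real[OF fm] by auto
  have gm': "(\<lambda>x. g x \<bullet> e) \<in> borel_measurable lebesgue" for e by measurable
  have "\<exists>h. h \<in> borel_measurable borel \<and> (AE x in lborel. g x \<bullet> e = h x)" for e
    using completion_ex_borel_measurable_real[OF gm'[of e]] by auto
  then obtain g' where g': "\<And>e. g' e \<in> borel_measurable borel" "\<And>e. AE x in lborel. g x \<bullet> e = g' e x"
    by metis
  have B: "axis 1 1 \<in> (Basis :: (real^2) set)" "axis 2 1 \<in> (Basis :: (real^2) set)"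
    by (auto simp: axis_in_Basis_iff)
  have parts: "(\<integral>y. f' y * frechet_derivative \<phi> (at y) e \<partial>lborel) = - (\<integral>y. g' e y * \<phi> y \<partial>lborel)"
    if "\<phi> \<in> test_functions UNIV" "e \<in> Basis" for \<phi> e
    using weak_gradient_component[OF wg that]
      lebesgue_integral_borel_version[OF fm f' borel_measurable_continuous_onI[OF test_function_partial_continuous[OF that]]]
      lebesgue_integral_borel_version[OF gm' g' borel_measurable_continuous_onI[OF test_function_continuous[OF that(1)]]]
    by simp
  have "(\<integral>\<^sup>+x. ennreal (f x ^ 4) \<partial>lebesgue_on UNIV) = (\<integral>\<^sup>+x. ennreal (f' x ^ 4) \<partial>lborel)"
    unfolding lebesgue_on_UNIV_eq nn_integral_completion
    by (rule nn_integral_cong_AE) (use f'(2) in eventually_elim, simp)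
  also have "\<dots> \<le> ennreal (256 * (64 * W\<^sup>2)) * (\<integral>\<^sup>+x. ennreal ((g' (axis 1 1) x)\<^sup>2 + (g' (axis 2 1) x)\<^sup>2) \<partial>lborel)"
  proof (rule L4_bound_weakly_differentiable)
    show "loc_integrable f'" by (rule loc_integrable_borel_version[OF loc(1) fm f'])
    show "loc_integrable (g' (axis 1 1))" "loc_integrable (g' (axis 2 1))"
      by (rule loc_integrable_borel_version[OF loc_comp gm' g'])+
    show "emeasure lborel {p. l < \<bar>f' p\<bar>} \<le> ennreal (W\<^sup>2 / l\<^sup>2)" if "0 < l" for l
      using weak_L2_norm_bound[OF fin that] emeasure_borel_version[OF fm f', of l] by (simp add: W_def)
  qed (use parts B in auto)
  also have "(\<integral>\<^sup>+x. ennreal ((g' (axis 1 1) x)\<^sup>2 + (g' (axis 2 1) x)\<^sup>2) \<partial>lborel)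
     = (\<integral>\<^sup>+x. ennreal ((norm (g x))\<^sup>2) \<partial>lebesgue_on UNIV)"
    unfolding lebesgue_on_UNIV_eq nn_integral_completion norm_real_2
    by (rule nn_integral_cong_AE) (use g'(2)[of "axis 1 1"] g'(2)[of "axis 2 1"] in eventually_elim, simp)
  also have "ennreal (256 * (64 * W\<^sup>2)) * (\<integral>\<^sup>+x. ennreal ((norm (g x))\<^sup>2) \<partial>lebesgue_on UNIV)
     \<le> ennreal (20736 * W\<^sup>2) * (\<integral>\<^sup>+x. ennreal ((norm (g x))\<^sup>2) \<partial>lebesgue_on UNIV)"
    by (intro mult_right_mono ennreal_leI) auto
  finally have "(\<integral>\<^sup>+x. ennreal (f x ^ 4) \<partial>lebesgue_on UNIV)
      \<le> ennreal (20736 * W\<^sup>2) * (\<integral>\<^sup>+x. ennreal ((norm (g x))\<^sup>2) \<partial>lebesgue_on UNIV)" .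
  moreover have "(\<integral>\<^sup>+x. ennreal ((norm (g x))\<^sup>2) \<partial>lebesgue_on UNIV) < \<infinity>"
    using gfin by (rule Lp_norm_2_finite_iff[THEN iffD1])
  moreover have "0 \<le> W" by (simp add: W_def)
  ultimately show ?thesis
    unfolding Lp_norm_4 W g_def[symmetric] Lp_norm_2 by (intro norm_inequality_from_integrals)
qed

section \<open>The inequality on \<open>H10 \<Omega>\<close>\<close>

lemma enn_powr_tendsto_0:
  assumes "(\<lambda>k. enn_powr (x k) (1/2)) \<longlonglongrightarrow> 0"
  shows "x \<longlonglongrightarrow> 0"
proof -
  have "(\<lambda>k. enn_powr (x k) (1/2) * enn_powr (x k) (1/2)) \<longlonglongrightarrow> 0 * 0"
    using assms by (intro tendsto_mult_ennreal) auto
  moreover have "enn_powr y (1/2) * enn_powr y (1/2) = y" for y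
    by (cases y) (auto simp: enn_powr_def ennreal_mult[symmetric] powr_add[symmetric])
  ultimately show ?thesis by simp
qed

lemma chebyshev_L2:
  fixes u :: "'a::euclidean_space \<Rightarrow> real"
  assumes [measurable]: "\<Omega> \<in> sets lebesgue" and u: "u \<in> borel_measurable (lebesgue_on \<Omega>)" and "0 < \<alpha>"
  shows "emeasure lebesgue {x \<in> \<Omega>. \<alpha> < \<bar>u x\<bar>} \<le> ennreal (1 / \<alpha>\<^sup>2) * (\<integral>\<^sup>+x. ennreal ((u x)\<^sup>2) \<partial>lebesgue_on \<Omega>)"
    and "{x \<in> \<Omega>. \<alpha> < \<bar>u x\<bar>} \<in> sets lebesgue"
proof -
  note [measurable] = u
  have "{x \<in> space (lebesgue_on \<Omega>). \<alpha> < \<bar>u x\<bar>} \<in> sets (lebesgue_on \<Omega>)" by measurable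
  then have s: "{x \<in> \<Omega>. \<alpha> < \<bar>u x\<bar>} \<in> sets (lebesgue_on \<Omega>)" by simp
  then show "{x \<in> \<Omega>. \<alpha> < \<bar>u x\<bar>} \<in> sets lebesgue"
    by (simp add: sets_restrict_space_iff)
  have "emeasure lebesgue {x \<in> \<Omega>. \<alpha> < \<bar>u x\<bar>} = emeasure (lebesgue_on \<Omega>) {x \<in> \<Omega>. \<alpha> < \<bar>u x\<bar>}"
    by (intro emeasure_restrict_space[symmetric]) auto
  also have "\<dots> \<le> emeasure (lebesgue_on \<Omega>) {x \<in> space (lebesgue_on \<Omega>). 1 \<le> ennreal (1 / \<alpha>\<^sup>2) * ennreal ((u x)\<^sup>2)}"
  proof (rule emeasure_mono)
    show "{x \<in> \<Omega>. \<alpha> < \<bar>u x\<bar>} \<subseteq> {x \<in> space (lebesgue_on \<Omega>). 1 \<le> ennreal (1 / \<alpha>\<^sup>2) * ennreal ((u x)\<^sup>2)}"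
    proof safe
      fix x assume "\<alpha> < \<bar>u x\<bar>"
      then have "\<alpha>\<^sup>2 \<le> (u x)\<^sup>2" using \<open>0 < \<alpha>\<close> by (simp add: abs_le_square_iff[symmetric])
      then have "1 \<le> 1 / \<alpha>\<^sup>2 * (u x)\<^sup>2" using \<open>0 < \<alpha>\<close> by (simp add: field_simps)
      then show "1 \<le> ennreal (1 / \<alpha>\<^sup>2) * ennreal ((u x)\<^sup>2)"
        by (simp add: ennreal_mult[symmetric])
    qed simp
  qed measurable
  also have "\<dots> \<le> ennreal (1 / \<alpha>\<^sup>2) * (\<integral>\<^sup>+x. ennreal ((u x)\<^sup>2) * indicator (space (lebesgue_on \<Omega>)) x \<partial>lebesgue_on \<Omega>)"
    by (rule nn_integral_Markov_inequality) measurable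
  also have "(\<integral>\<^sup>+x. ennreal ((u x)\<^sup>2) * indicator (space (lebesgue_on \<Omega>)) x \<partial>lebesgue_on \<Omega>) = (\<integral>\<^sup>+x. ennreal ((u x)\<^sup>2) \<partial>lebesgue_on \<Omega>)"
    by (intro nn_integral_cong) simp
  finally show "emeasure lebesgue {x \<in> \<Omega>. \<alpha> < \<bar>u x\<bar>} \<le> ennreal (1 / \<alpha>\<^sup>2) * (\<integral>\<^sup>+x. ennreal ((u x)\<^sup>2) \<partial>lebesgue_on \<Omega>)" .
qed

lemma weak_L2_norm_finite:
  fixes f :: "'a::euclidean_space \<Rightarrow> real"
  assumes \<Omega>: "\<Omega> \<in> sets lebesgue" and f: "f \<in> Lp 2 \<Omega>"
  shows "weak_Lp_norm 2 \<Omega> f < \<infinity>"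
proof -
  have fm: "f \<in> borel_measurable (lebesgue_on \<Omega>)" using f by (simp add: Lp_def)
  have "(\<integral>\<^sup>+x. ennreal ((f x)\<^sup>2) \<partial>lebesgue_on \<Omega>) < \<infinity>"
    using f Lp_norm_2_finite_iff[of \<Omega> f] by (simp add: Lp_def)
  then obtain N where N: "(\<integral>\<^sup>+x. ennreal ((f x)\<^sup>2) \<partial>lebesgue_on \<Omega>) = ennreal N" "0 \<le> N"
    by (cases "(\<integral>\<^sup>+x. ennreal ((f x)\<^sup>2) \<partial>lebesgue_on \<Omega>)") auto
  define C where "C = sqrt N + 1"
  have C: "0 < C" "N \<le> C\<^sup>2"
    using N by (auto simp: C_def power2_sum add_nonneg_pos)
  have "distribution_fun \<Omega> f \<alpha> \<le> ennreal (C powr 2 / \<alpha> powr 2)" if "0 < \<alpha>" for \<alpha>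
  proof -
    have "distribution_fun \<Omega> f \<alpha> \<le> ennreal (1 / \<alpha>\<^sup>2) * ennreal N"
      using chebyshev_L2(1)[OF \<Omega> fm that] N by (simp add: distribution_fun_def)
    also have "\<dots> = ennreal (1 / \<alpha>\<^sup>2 * N)" by (rule ennreal_mult[symmetric]) (use N in auto)
    also have "\<dots> \<le> ennreal (C powr 2 / \<alpha> powr 2)"
      using C that by (intro ennreal_leI) (simp add: divide_right_mono)
    finally show ?thesis .
  qed
  then have "weak_Lp_norm 2 \<Omega> f \<le> ennreal C"
    unfolding weak_Lp_norm_def using C by (intro Inf_lower) auto
  then show ?thesis by (simp add: le_less_trans)
qed

lemma test_function_eq_0: "\<phi> \<in> test_functions \<Omega> \<Longrightarrow> x \<notin> \<Omega> \<Longrightarrow> \<phi> x = 0"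
  using closure_subset[of "{x. \<phi> x \<noteq> 0}"] by (auto simp: test_functions_def)

lemma gradient_eq_0: "\<phi> \<in> test_functions \<Omega> \<Longrightarrow> x \<notin> \<Omega> \<Longrightarrow> gradient \<phi> x = 0"
  using test_function_partial_eq_0[of \<phi> \<Omega> x] unfolding gradient_def
  by (intro sum.neutral) (auto simp: test_functions_def)

lemma gradient_measurable: "\<phi> \<in> test_functions \<Omega> \<Longrightarrow> gradient \<phi> \<in> borel_measurable borel"
  unfolding gradient_def[abs_def]
  by (intro borel_measurable_continuous_onI continuous_intros test_function_partial_continuous)

lemma nn_integral_lebesgue_on_eq_lborel:
  assumes \<Omega>: "\<Omega> \<in> sets lebesgue" and "\<And>x. x \<notin> \<Omega> \<Longrightarrow> w x = 0"
  shows "(\<integral>\<^sup>+x. w x \<partial>lebesgue_on \<Omega>) = (\<integral>\<^sup>+x. w x \<partial>lborel)"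
proof -
  have "(\<integral>\<^sup>+x. w x \<partial>lebesgue_on \<Omega>) = (\<integral>\<^sup>+x. w x * indicator \<Omega> x \<partial>lebesgue)"
    using \<Omega> by (simp add: nn_integral_restrict_space)
  also have "\<dots> = (\<integral>\<^sup>+x. w x \<partial>lebesgue)"
    by (intro nn_integral_cong) (use assms(2) in \<open>auto simp: indicator_def\<close>)
  finally show ?thesis by (simp add: nn_integral_completion)
qed

lemma borel_measurable_lebesgue_on:
  "u \<in> borel_measurable borel \<Longrightarrow> u \<in> borel_measurable (lebesgue_on \<Omega>)"
  by (intro measurable_restrict_space1) (simp add: measurable_completion)

text \<open>
  A test function inherits a weak \<open>L\<^sup>2\<close> bound from any \<open>f\<close> that is close to it in \<open>L\<^sup>2\<close>: the set
  \<open>{x. l < \<bar>\<phi> x\<bar>}\<close> is covered by the sets where \<open>\<bar>f\<bar>\<close> and where \<open>\<bar>\<phi> - f\<bar>\<close> exceed \<open>l / 2\<close>, and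
  Chebyshev's inequality bounds the latter. The bound involves the weak norm of \<open>f\<close> and an error
  which vanishes in the limit.
\<close>
lemma L4_bound_test_function:
  fixes \<phi> f :: "real^2 \<Rightarrow> real"
  assumes \<Omega>: "\<Omega> \<in> sets lebesgue" and \<phi>: "\<phi> \<in> test_functions \<Omega>"
    and f: "f \<in> borel_measurable (lebesgue_on \<Omega>)"
    and W: "\<And>l. 0 < l \<Longrightarrow> emeasure lebesgue {x \<in> \<Omega>. l < \<bar>f x\<bar>} \<le> ennreal (W / l\<^sup>2)" "0 \<le> W"
    and d: "(\<integral>\<^sup>+x. ennreal ((\<phi> x - f x)\<^sup>2) \<partial>lebesgue_on \<Omega>) = ennreal d" "0 \<le> d"
  shows "(\<integral>\<^sup>+x. ennreal (\<phi> x ^ 4) \<partial>lebesgue_on \<Omega>)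
    \<le> ennreal (256 * (4 * W + 4 * d)) * (\<integral>\<^sup>+x. ennreal ((norm (gradient \<phi> x))\<^sup>2) \<partial>lebesgue_on \<Omega>)"
proof -
  note \<phi>c = test_function_continuous[OF \<phi>]
  have \<phi>m: "\<phi> \<in> borel_measurable borel" using \<phi>c by (rule borel_measurable_continuous_onI)
  have \<phi>f: "(\<lambda>x. \<phi> x - f x) \<in> borel_measurable (lebesgue_on \<Omega>)"
    using borel_measurable_lebesgue_on[OF \<phi>m] f by measurable
  have B: "axis 1 1 \<in> (Basis :: (real^2) set)" "axis 2 1 \<in> (Basis :: (real^2) set)"
    by (auto simp: axis_in_Basis_iff)
  define G1 where "G1 x = frechet_derivative \<phi> (at x) (axis 1 1)" for x
  define G2 where "G2 x = frechet_derivative \<phi> (at x) (axis 2 1)" for x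
  have "(\<integral>\<^sup>+x. ennreal (\<phi> x ^ 4) \<partial>lborel)
    \<le> ennreal (256 * (4 * W + 4 * d)) * (\<integral>\<^sup>+x. ennreal ((G1 x)\<^sup>2 + (G2 x)\<^sup>2) \<partial>lborel)"
  proof (rule L4_bound_C1[OF \<phi>m])
    show "continuous_on UNIV G1" "continuous_on UNIV G2"
      unfolding G1_def G2_def by (intro test_function_partial_continuous[OF \<phi>] B)+
    show "((\<lambda>s. \<phi> (vector [s, y])) has_real_derivative G1 (vector [x, y])) (at x)" for x y
      by (rule line_derivative_plane(1))
         (use test_function_line_derivative[OF \<phi>, of _ "axis 1 1" 0] in \<open>simp add: G1_def\<close>)
    show "((\<lambda>s. \<phi> (vector [x, s])) has_real_derivative G2 (vector [x, y])) (at y)" for x y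
      by (rule line_derivative_plane(2))
         (use test_function_line_derivative[OF \<phi>, of _ "axis 2 1" 0] in \<open>simp add: G2_def\<close>)
    show "0 \<le> 4 * W + 4 * d" using W d by simp
    fix l :: real assume "0 < l"
    then have l2: "0 < l / 2" by simp
    have "{p. l < \<bar>\<phi> p\<bar>} \<in> sets borel" using \<phi>m by measurable
    then have "emeasure lborel {p. l < \<bar>\<phi> p\<bar>} = emeasure lebesgue {p. l < \<bar>\<phi> p\<bar>}" by simp
    also have "\<dots> \<le> emeasure lebesgue ({x \<in> \<Omega>. l / 2 < \<bar>f x\<bar>} \<union> {x \<in> \<Omega>. l / 2 < \<bar>\<phi> x - f x\<bar>})"
    proof (rule emeasure_mono)
      show "{p. l < \<bar>\<phi> p\<bar>} \<subseteq> {x \<in> \<Omega>. l / 2 < \<bar>f x\<bar>} \<union> {x \<in> \<Omega>. l / 2 < \<bar>\<phi> x - f x\<bar>}"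
      proof
        fix x assume "x \<in> {p. l < \<bar>\<phi> p\<bar>}"
        moreover from this have "x \<in> \<Omega>" using test_function_eq_0[OF \<phi>, of x] \<open>0 < l\<close> by (cases "x \<in> \<Omega>") auto
        moreover have "\<bar>\<phi> x\<bar> \<le> \<bar>f x\<bar> + \<bar>\<phi> x - f x\<bar>" by linarith
        ultimately show "x \<in> {x \<in> \<Omega>. l / 2 < \<bar>f x\<bar>} \<union> {x \<in> \<Omega>. l / 2 < \<bar>\<phi> x - f x\<bar>}" by auto
      qed
      show "{x \<in> \<Omega>. l / 2 < \<bar>f x\<bar>} \<union> {x \<in> \<Omega>. l / 2 < \<bar>\<phi> x - f x\<bar>} \<in> sets lebesgue"
        using chebyshev_L2(2)[OF \<Omega> f l2] chebyshev_L2(2)[OF \<Omega> \<phi>f l2] by (rule sets.Un)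
    qed
    also have "\<dots> \<le> emeasure lebesgue {x \<in> \<Omega>. l / 2 < \<bar>f x\<bar>} + emeasure lebesgue {x \<in> \<Omega>. l / 2 < \<bar>\<phi> x - f x\<bar>}"
      using chebyshev_L2(2)[OF \<Omega> f l2] chebyshev_L2(2)[OF \<Omega> \<phi>f l2] by (rule emeasure_subadditive)
    also have "\<dots> \<le> ennreal (W / (l / 2)\<^sup>2) + ennreal (1 / (l / 2)\<^sup>2) * ennreal d"
      using chebyshev_L2(1)[OF \<Omega> \<phi>f l2] W(1)[OF l2] unfolding d by (rule add_mono[rotated])
    also have "\<dots> = ennreal (W / (l / 2)\<^sup>2 + 1 / (l / 2)\<^sup>2 * d)"
      using W d \<open>0 < l\<close> by (subst ennreal_plus) (auto simp: ennreal_mult[symmetric])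
    also have "W / (l / 2)\<^sup>2 + 1 / (l / 2)\<^sup>2 * d = (4 * W + 4 * d) / l\<^sup>2"
      using \<open>0 < l\<close> by (simp add: field_simps power2_eq_square)
    finally show "emeasure lborel {p. l < \<bar>\<phi> p\<bar>} \<le> ennreal ((4 * W + 4 * d) / l\<^sup>2)" .
  qed
  moreover have "(\<integral>\<^sup>+x. ennreal (\<phi> x ^ 4) \<partial>lebesgue_on \<Omega>) = (\<integral>\<^sup>+x. ennreal (\<phi> x ^ 4) \<partial>lborel)"
    using test_function_eq_0[OF \<phi>] by (intro nn_integral_lebesgue_on_eq_lborel \<Omega>) simp
  moreover have "(\<integral>\<^sup>+x. ennreal ((norm (gradient \<phi> x))\<^sup>2) \<partial>lebesgue_on \<Omega>)
     = (\<integral>\<^sup>+x. ennreal ((norm (gradient \<phi> x))\<^sup>2) \<partial>lborel)"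
    using gradient_eq_0[OF \<phi>] by (intro nn_integral_lebesgue_on_eq_lborel \<Omega>) simp
  moreover have "(norm (gradient \<phi> x))\<^sup>2 = (G1 x)\<^sup>2 + (G2 x)\<^sup>2" for x
    using B by (simp add: norm_real_2 gradient_inner_Basis G1_def G2_def)
  ultimately show ?thesis by simp
qed

lemma norm_square_le_twice: "(norm (x::'a::real_normed_vector))\<^sup>2 \<le> 2 * (norm (x - y))\<^sup>2 + 2 * (norm y)\<^sup>2"
proof -
  have "(norm x)\<^sup>2 \<le> (norm (x - y) + norm y)\<^sup>2"
    using norm_triangle_ineq[of "x - y" y] by (intro power_mono) auto
  also have "\<dots> \<le> 2 * (norm (x - y))\<^sup>2 + 2 * (norm y)\<^sup>2"
    using zero_le_power2[of "norm (x - y) - norm y"] by (simp add: power2_sum power2_diff)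
  finally show ?thesis .
qed

lemma L2_convergence_AE_subseq:
  fixes u :: "nat \<Rightarrow> 'a \<Rightarrow> real"
  assumes [measurable]: "\<And>n. u n \<in> borel_measurable M"
    and fin: "\<And>n. (\<integral>\<^sup>+x. ennreal ((u n x)\<^sup>2) \<partial>M) < \<infinity>"
    and lim: "(\<lambda>n. \<integral>\<^sup>+x. ennreal ((u n x)\<^sup>2) \<partial>M) \<longlonglongrightarrow> 0"
  obtains r where "strict_mono r" "AE x in M. (\<lambda>n. u (r n) x) \<longlonglongrightarrow> 0"
proof -
  have i: "integrable M (\<lambda>x. (u n x)\<^sup>2)" for n
    using fin[of n] by (intro integrableI_bounded) auto
  have "(\<lambda>n. enn2real (\<integral>\<^sup>+x. ennreal ((u n x)\<^sup>2) \<partial>M)) \<longlonglongrightarrow> enn2real 0"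
    using lim by (intro tendsto_enn2real) auto
  then have "(\<lambda>n. \<integral>x. norm ((u n x)\<^sup>2) \<partial>M) \<longlonglongrightarrow> 0"
    by (simp add: integral_eq_nn_integral)
  from tendsto_L1_AE_subseq[OF i this] obtain r where
    r: "strict_mono r" "AE x in M. (\<lambda>n. (u (r n) x)\<^sup>2) \<longlonglongrightarrow> 0" by auto
  have "AE x in M. (\<lambda>n. u (r n) x) \<longlonglongrightarrow> 0"
    using r(2)
  proof eventually_elim
    case (elim x)
    then have "(\<lambda>n. sqrt ((u (r n) x)\<^sup>2)) \<longlonglongrightarrow> sqrt 0" by (rule tendsto_real_sqrt)
    then show ?case by (simp add: tendsto_rabs_zero_iff)
  qed
  with r(1) show ?thesis by (rule that)
qed

text \<open>
  Passing to the limit in the approximating test functions avoids extending \<open>f\<close> by zero to a weakly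
  differentiable function on the plane. They converge almost everywhere along a subsequence, and
  the bounds of \<open>L4_bound_test_function\<close> converge.
\<close>
lemma norm_inequality_H10:
  fixes f :: "real^2 \<Rightarrow> real"
  assumes \<Omega>: "\<Omega> \<in> sets lebesgue" and f: "f \<in> H10 \<Omega>"
  shows "Lp_norm 4 \<Omega> f \<le> ennreal 12 * enn_powr (weak_Lp_norm 2 \<Omega> f) (1/2)
      * enn_powr (Lp_norm 2 \<Omega> (weak_gradient \<Omega> f)) (1/2)"
proof -
  let ?M = "lebesgue_on \<Omega>"
  define g where "g = weak_gradient \<Omega> f"
  define W where "W = enn2real (weak_Lp_norm 2 \<Omega> f)"
  define \<Gamma> where "\<Gamma> = (\<integral>\<^sup>+x. ennreal ((norm (g x))\<^sup>2) \<partial>?M)"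
  have f2: "f \<in> Lp 2 \<Omega>" and g2: "g \<in> Lp 2 \<Omega>"
    using f by (auto simp: H10_def H1_def homogeneous_H1_def g_def)
  have fm[measurable]: "f \<in> borel_measurable ?M" and gm[measurable]: "g \<in> borel_measurable ?M"
    using f2 g2 by (auto simp: Lp_def)
  have fin: "weak_Lp_norm 2 \<Omega> f < \<infinity>" by (rule weak_L2_norm_finite[OF \<Omega> f2])
  have W: "weak_Lp_norm 2 \<Omega> f = ennreal W" using fin by (simp add: W_def)
  have \<Gamma>: "\<Gamma> < \<infinity>" using g2 unfolding \<Gamma>_def by (intro Lp_norm_2_finite_iff[THEN iffD1]) (simp add: Lp_def)
  have "\<exists>\<phi>. (\<forall>k::nat. \<phi> k \<in> test_functions \<Omega>) \<and>
     (\<lambda>k. Lp_norm 2 \<Omega> (\<lambda>x. \<phi> k x - f x)) \<longlonglongrightarrow> 0 \<and>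
     (\<lambda>k. Lp_norm 2 \<Omega> (\<lambda>x. gradient (\<phi> k) x - g x)) \<longlonglongrightarrow> 0"
    using f unfolding H10_def g_def by (rule CollectE) (rule conjunct2)
  then obtain \<psi> where \<psi>': "(\<forall>k::nat. \<psi> k \<in> test_functions \<Omega>) \<and>
     (\<lambda>k. Lp_norm 2 \<Omega> (\<lambda>x. \<psi> k x - f x)) \<longlonglongrightarrow> 0 \<and>
     (\<lambda>k. Lp_norm 2 \<Omega> (\<lambda>x. gradient (\<psi> k) x - g x)) \<longlonglongrightarrow> 0" ..
  note \<psi> = \<psi>'[THEN conjunct1, THEN spec] \<psi>'[THEN conjunct2, THEN conjunct1] \<psi>'[THEN conjunct2, THEN conjunct2]
  define D where "D k = (\<integral>\<^sup>+x. ennreal ((\<psi> k x - f x)\<^sup>2) \<partial>?M)" for k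
  define E where "E k = (\<integral>\<^sup>+x. ennreal ((norm (gradient (\<psi> k) x - g x))\<^sup>2) \<partial>?M)" for k
  have D: "D \<longlonglongrightarrow> 0" using \<psi>(2) unfolding Lp_norm_2 D_def real_norm_def power2_abs by (rule enn_powr_tendsto_0)
  have E: "E \<longlonglongrightarrow> 0" using \<psi>(3) unfolding Lp_norm_2 E_def by (rule enn_powr_tendsto_0)
  \<comment> \<open>Finitely many \<open>D k\<close> may be infinite, since convergence to 0 constrains only the tail;
    they are cut off.\<close>
  have "\<forall>\<^sub>F k in sequentially. D k < 1" using D by (rule order_tendstoD) simp
  then obtain k0 where k0: "\<And>k. k0 \<le> k \<Longrightarrow> D k < 1" by (auto simp: eventually_sequentially)
  have \<psi>m[measurable]: "\<psi> k \<in> borel_measurable ?M" for k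
    by (intro borel_measurable_lebesgue_on borel_measurable_continuous_onI test_function_continuous[OF \<psi>(1)])
  have \<psi>gm[measurable]: "gradient (\<psi> k) \<in> borel_measurable ?M" for k
    by (intro borel_measurable_lebesgue_on gradient_measurable[OF \<psi>(1)])
  have Dfin: "D (k + k0) < \<infinity>" for k
    using k0[of "k + k0"] by (simp add: less_trans[OF _ ennreal_one_less_top])
  obtain r where r: "strict_mono r" "AE x in ?M. (\<lambda>n. \<psi> (r n + k0) x - f x) \<longlonglongrightarrow> 0"
  proof (rule L2_convergence_AE_subseq[of "\<lambda>k x. \<psi> (k + k0) x - f x" ?M])
    show "(\<integral>\<^sup>+x. ennreal ((\<psi> (k + k0) x - f x)\<^sup>2) \<partial>?M) < \<infinity>" for k using Dfin[of k] by (simp add: D_def)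
    show "(\<lambda>k. \<integral>\<^sup>+x. ennreal ((\<psi> (k + k0) x - f x)\<^sup>2) \<partial>?M) \<longlonglongrightarrow> 0"
      using LIMSEQ_ignore_initial_segment[OF D, of k0] by (simp add: D_def)
  qed auto
  define s where "s n = r n + k0" for n
  have s: "filterlim s sequentially sequentially"
    using filterlim_compose[OF filterlim_add_const_nat_at_top[of k0] filterlim_subseq[OF r(1)]]
    by (simp add: s_def[abs_def])
  have Ds: "(\<lambda>n. D (s n)) \<longlonglongrightarrow> 0" and Es: "(\<lambda>n. E (s n)) \<longlonglongrightarrow> 0"
    using D E s by (auto intro: filterlim_compose)
  define K where "K n = ennreal (256 * (4 * W\<^sup>2 + 4 * enn2real (D (s n)))) * (2 * E (s n) + 2 * \<Gamma>)" for n
  have "(\<integral>\<^sup>+x. ennreal (f x ^ 4) \<partial>?M) \<le> ennreal (256 * (4 * W\<^sup>2 + 4 * 0)) * (2 * 0 + 2 * \<Gamma>)"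
  proof (rule nn_integral_le_of_AE_tendsto)
    show "(\<lambda>x. ennreal (\<psi> (s n) x ^ 4)) \<in> borel_measurable ?M" for n by measurable
    show "AE x in ?M. (\<lambda>n. ennreal (\<psi> (s n) x ^ 4)) \<longlonglongrightarrow> ennreal (f x ^ 4)"
      using r(2)
    proof eventually_elim
      case (elim x)
      then have "(\<lambda>n. \<psi> (s n) x) \<longlonglongrightarrow> f x" unfolding s_def by (rule LIM_zero_cancel)
      then show ?case by (intro tendsto_ennrealI tendsto_power)
    qed
    show "(\<integral>\<^sup>+x. ennreal (\<psi> (s n) x ^ 4) \<partial>?M) \<le> K n" for n
    proof -
      have "(\<integral>\<^sup>+x. ennreal ((norm (gradient (\<psi> (s n)) x))\<^sup>2) \<partial>?M)
        \<le> (\<integral>\<^sup>+x. 2 * ennreal ((norm (gradient (\<psi> (s n)) x - g x))\<^sup>2) + 2 * ennreal ((norm (g x))\<^sup>2) \<partial>?M)"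
      proof (rule nn_integral_mono)
        fix x
        have "ennreal ((norm (gradient (\<psi> (s n)) x))\<^sup>2)
           \<le> ennreal (2 * (norm (gradient (\<psi> (s n)) x - g x))\<^sup>2 + 2 * (norm (g x))\<^sup>2)"
          by (intro ennreal_leI norm_square_le_twice)
        then show "ennreal ((norm (gradient (\<psi> (s n)) x))\<^sup>2)
           \<le> 2 * ennreal ((norm (gradient (\<psi> (s n)) x - g x))\<^sup>2) + 2 * ennreal ((norm (g x))\<^sup>2)"
          by (simp add: ennreal_mult)
      qed
      also have "\<dots> = 2 * E (s n) + 2 * \<Gamma>"
        unfolding E_def \<Gamma>_def by (simp add: nn_integral_add nn_integral_cmult)
      finally have e: "(\<integral>\<^sup>+x. ennreal ((norm (gradient (\<psi> (s n)) x))\<^sup>2) \<partial>?M) \<le> 2 * E (s n) + 2 * \<Gamma>" .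
      have "D (s n) = ennreal (enn2real (D (s n)))" using Dfin[of "r n"] by (simp add: s_def)
      then have "(\<integral>\<^sup>+x. ennreal (\<psi> (s n) x ^ 4) \<partial>?M)
        \<le> ennreal (256 * (4 * W\<^sup>2 + 4 * enn2real (D (s n)))) * (\<integral>\<^sup>+x. ennreal ((norm (gradient (\<psi> (s n)) x))\<^sup>2) \<partial>?M)"
        using weak_L2_norm_bound[OF fin]
        by (intro L4_bound_test_function[OF \<Omega> \<psi>(1) fm]) (auto simp: W_def D_def)
      also have "\<dots> \<le> K n" unfolding K_def by (intro mult_left_mono e) auto
      finally show ?thesis .
    qed
    have "(\<lambda>n. enn2real (D (s n))) \<longlonglongrightarrow> enn2real 0" using Ds by (intro tendsto_enn2real) auto
    then have D0: "(\<lambda>n. enn2real (D (s n))) \<longlonglongrightarrow> 0" by simp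
    show "K \<longlonglongrightarrow> ennreal (256 * (4 * W\<^sup>2 + 4 * 0)) * (2 * 0 + 2 * \<Gamma>)"
      unfolding K_def
      by (intro tendsto_mult_ennreal tendsto_ennrealI tendsto_intros tendsto_add ennreal_tendsto_cmult D0 Es)
         (use \<Gamma> in \<open>auto simp: ennreal_mult_eq_top_iff\<close>)
  qed
  also have "\<dots> = ennreal (2048 * W\<^sup>2) * \<Gamma>"
  proof -
    have "ennreal (256 * (4 * W\<^sup>2 + 4 * 0)) * 2 = ennreal (256 * (4 * W\<^sup>2 + 4 * 0) * 2)"
      by (subst ennreal_mult) auto
    then show ?thesis by (simp add: mult.assoc[symmetric])
  qed
  also have "\<dots> \<le> ennreal (20736 * W\<^sup>2) * \<Gamma>"
    by (intro mult_right_mono ennreal_leI) auto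
  finally have "(\<integral>\<^sup>+x. ennreal (f x ^ 4) \<partial>?M) \<le> ennreal (20736 * W\<^sup>2) * \<Gamma>" .
  moreover have "0 \<le> W" by (simp add: W_def)
  ultimately have "enn_powr (\<integral>\<^sup>+x. ennreal (f x ^ 4) \<partial>?M) (1/4)
      \<le> ennreal 12 * enn_powr (ennreal W) (1/2) * enn_powr (enn_powr \<Gamma> (1/2)) (1/2)"
    using \<Gamma> by (intro norm_inequality_from_integrals)
  then show ?thesis
    unfolding Lp_norm_4 W g_def[symmetric] Lp_norm_2 \<Gamma>_def .
qed

theorem mainTheorem2:
  shows "\<exists>c::real. c > 0 \<and>
    (\<forall>f \<in> weak_Lp 2 (UNIV :: (real^2) set) \<inter> homogeneous_H1 UNIV.
       Lp_norm 4 UNIV f \<le> ennreal c * enn_powr (weak_Lp_norm 2 UNIV f) (1/2)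
                                     * enn_powr (Lp_norm 2 UNIV (weak_gradient UNIV f)) (1/2)) \<and>
    (\<forall>\<Omega> :: (real^2) set. bounded_Lipschitz_domain \<Omega> \<longrightarrow>
       (\<forall>f \<in> H10 \<Omega>.
          Lp_norm 4 \<Omega> f \<le> ennreal c * enn_powr (weak_Lp_norm 2 \<Omega> f) (1/2)
                                     * enn_powr (Lp_norm 2 \<Omega> (weak_gradient \<Omega> f)) (1/2)))"
proof (intro exI[of _ 12] conjI ballI allI impI)
  fix f :: "real^2 \<Rightarrow> real"
  assume "f \<in> weak_Lp 2 UNIV \<inter> homogeneous_H1 UNIV"
  then show "Lp_norm 4 UNIV f \<le> ennreal 12 * enn_powr (weak_Lp_norm 2 UNIV f) (1/2)
      * enn_powr (Lp_norm 2 UNIV (weak_gradient UNIV f)) (1/2)"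
    by (rule norm_inequality_plane)
next
  fix \<Omega> :: "(real^2) set" and f
  assume "bounded_Lipschitz_domain \<Omega>" and f: "f \<in> H10 \<Omega>"
  then have "open \<Omega>" by (simp add: bounded_Lipschitz_domain_def)
  then have "\<Omega> \<in> sets lebesgue" by simp
  then show "Lp_norm 4 \<Omega> f \<le> ennreal 12 * enn_powr (weak_Lp_norm 2 \<Omega> f) (1/2)
      * enn_powr (Lp_norm 2 \<Omega> (weak_gradient \<Omega> f)) (1/2)"
    using f by (rule norm_inequality_H10)
qed simp

end
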